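(* Let $R$ be a set and let $\pi$ be an $R$-deco polygon. The element $\mathrm B(\pi)$ associated to $\pi$ is a $0$-cocycle in the bar construction $\mathrm B(\mathcal P_\bullet(R))$.
   Context: **Polygons.** An $R$-deco polygon is an oriented convex polygon with $N\ge2$ sides decorated by elements of $R$, with a distinguished root side. The orientation gives a linear order of sides with root side last; write $[a_1,\dots,a_{n+1}]$ ($a_{n+1}$ on the root). Weight $\chi=n$ = number of non-root sides. $v_0$ is the vertex between root and first side (first vertex), $v_k$ the vertex between the $k$-th and $(k+1)$-st side. $\mathcal P=\mathcal P_\bullet(R)$ is the exterior $\mathbb Q$-algebra (with unit) on the vector space with basis the $R$-deco polygons. An arrow goes from a vertex $v_k$ to the interior of a side $a_l$ (arrows with the same vertex and side are identified); it is trivial if $v_k$ is an endpoint of the side, forward if $l>k$, backward otherwise. For a non-trivial forward arrow $\alpha:v_k\to a_l$ put $\pi_\alpha^{rt}=[a_1,\dots,a_k,a_l,\dots,a_{n+1}]$, $\pi_\alpha^{co}=[a_{k+1},\dots,a_{l-1},a_l]$, $\mathrm{sgn}(\alpha)=1$; for a non-trivial backward arrow ($l<k$) put $\pi_\alpha^{rt}=[a_1,\dots,a_l,a_{k+1},\dots,a_{n+1}]$, $\pi_\alpha^{co}=[a_k,\dots,a_{l+1},a_l]$, $\mathrm{sgn}(\alpha)=(-1)^{k-l}$. Then $\partial\pi=\sum_\alpha\mathrm{sgn}(\alpha)\pi_\alpha^{rt}\wedge\pi_\alpha^{co}$ over non-trivial arrows, extended as a derivation with sign $(-1)^{\deg}$,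 $\deg$ = exterior degree; $(\mathcal P,\partial)$ is an augmented DGA. **Dissections.** Two arrows do not intersect if (for suitable endpoints on the sides) they have no point in common except possibly the starting point. An $n$-fold dissection $D$ of $\pi$ is the set of $n$ regions cut out by $n-1$ distinct, pairwise non-intersecting, non-trivial arrows. The root region is the one containing the first vertex and part of the root side. The dual tree $\tau(D)$ has the regions as vertices, the arrows as edges (joining the two adjacent regions), and the root region as root; it defines a partial order on the regions (root region first, a region precedes those further from the root along the tree). Each region gives an $R$-deco polygon by contracting all arrows in its boundary: for the root region, root side and orientation are those of $\pi$; for any other region, let $\alpha$ be the unique boundary arrow closest to the root (the edge of $\tau(D)$ leading towards the root); the root side is the one where $\alpha$ ends, and the orientation is that of $\pi$ if $\alpha$ is forward and the opposite one if $\alpha$ is backward. Denote this polygon $\pi^{co}_{D,\alpha}$. The sign of $D$ is $\mathrm{sgn}(D)=\prod_{\alpha\text{ backward arrow of }D}(-1)^{\chi(\pi^{co}_{D,\alpha})}$. **The element $\mathrm B(\pi)$.** It is the sum over $n\ge1$ of its components in $\mathcal P^{\otimes n}$ given by $\sum_D\mathrm{sgn}(D)\sum_\lambda[\pi_D^{\lambda(1)}|\cdots|\pi_D^{\lambda(n)}]$, over all $n$-fold dissections $D$ of $\pi$ and all linear orders $\lambda$ of the associated polygons $\pi_D^i$ compatible with the partial order of $\tau(D)$ (for $n=1$ this is $[\pi]$). **Bar construction.** $\mathrm B(\mathcal P)$ is the tensor coalgebra on the augmentation ideal of $\mathcal P$, with words $[x_1|\cdots|x_N]$ placed in degree $\sum(\deg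 x_i-1)$, and with differential $D_1+D_2$ of degree $+1$, where $$D_1[x_1|\cdots|x_N]=-\sum_{j=1}^{N-1}(-1)^{\sum_{i\le j}(\deg x_i-1)}[x_1|\cdots|x_j\wedge x_{j+1}|\cdots|x_N],$$ $$D_2[x_1|\cdots|x_N]=\sum_{j=1}^{N}(-1)^{\sum_{i<j}(\deg x_i-1)}[x_1|\cdots|\partial x_j|\cdots|x_N],$$ with $\deg$ the exterior degree. A $0$-cocycle is an element of degree $0$ killed by $D_1+D_2$. *)

theory Defs
  imports Complex_Main "HOL-Library.FSet" "HOL-Library.Poly_Mapping"
begin

section \<open>Free rational vector spaces\<close>

text \<open>\<^typ>\<open>'a \<Rightarrow>\<^sub>0 rat\<close> is the rational vector space with basis \<^typ>\<open>'a\<close>.\<close>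

definition scale :: "rat \<Rightarrow> ('a \<Rightarrow>\<^sub>0 rat) \<Rightarrow> ('a \<Rightarrow>\<^sub>0 rat)" where
  "scale c f = Poly_Mapping.map ((*) c) f"

definition basis :: "'a \<Rightarrow> ('a \<Rightarrow>\<^sub>0 rat)" where
  "basis x = Poly_Mapping.single x 1"

definition lin_ext :: "('a \<Rightarrow> ('b \<Rightarrow>\<^sub>0 rat)) \<Rightarrow> ('a \<Rightarrow>\<^sub>0 rat) \<Rightarrow> ('b \<Rightarrow>\<^sub>0 rat)" where
  "lin_ext F f = (\<Sum>x\<in>Poly_Mapping.keys f. scale (Poly_Mapping.lookup f x) (F x))"

lemma lookup_scale [simp]: "Poly_Mapping.lookup (scale c f) x = c * Poly_Mapping.lookup f x"
  by (simp add: scale_def Poly_Mapping.map.rep_eq when_def)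

lemma scale_simps [simp]:
  "scale 0 f = 0" "scale c 0 = 0" "scale 1 f = f" "scale c (scale d f) = scale (c * d) f"
  by (auto intro!: poly_mapping_eqI)

lemma scale_add: "scale c (f + g) = scale c f + scale c g"
  by (auto intro!: poly_mapping_eqI simp: lookup_add algebra_simps)

lemma scale_add_left: "scale (c + d) f = scale c f + scale d f"
  by (auto intro!: poly_mapping_eqI simp: lookup_add algebra_simps)

lemma scale_sum: "scale c (sum f A) = (\<Sum>x\<in>A. scale c (f x))"
  by (auto intro!: poly_mapping_eqI simp: lookup_sum sum_distrib_left)

lemma lin_ext_superset:
  assumes "finite A" "Poly_Mapping.keys f \<subseteq> A"
  shows "lin_ext F f = (\<Sum>x\<in>A. scale (Poly_Mapping.lookup f x) (F x))"
  unfolding lin_ext_def using assms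
  by (intro sum.mono_neutral_left) (auto simp: in_keys_iff)

lemma lin_ext_basis [simp]: "lin_ext F (basis x) = F x"
  by (simp add: lin_ext_def basis_def)

lemma lin_ext_zero [simp]: "lin_ext F 0 = 0"
  by (simp add: lin_ext_def)

lemma lin_ext_add: "lin_ext F (f + g) = lin_ext F f + lin_ext F g"
proof -
  let ?A = "Poly_Mapping.keys f \<union> Poly_Mapping.keys g"
  have "Poly_Mapping.keys (f + g) \<subseteq> ?A"
    by (rule Poly_Mapping.keys_add)
  then show ?thesis
    by (simp add: lin_ext_superset[of ?A] lookup_add scale_add_left sum.distrib)
qed

lemma lin_ext_scale: "lin_ext F (scale c f) = scale c (lin_ext F f)"
proof -
  have "Poly_Mapping.keys (scale c f) \<subseteq> Poly_Mapping.keys f"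
    by (auto simp: in_keys_iff)
  then show ?thesis
    by (simp add: lin_ext_superset[of "Poly_Mapping.keys f"] scale_sum)
qed

section \<open>Exterior algebras\<close>

text \<open>
  The exterior algebra on the vector space with basis \<^typ>\<open>'b\<close> has as its basis the monomials
  \<open>b\<^sub>1 \<and> \<dots> \<and> b\<^sub>k\<close> with \<open>b\<^sub>1 < \<dots> < b\<^sub>k\<close> for an arbitrary fixed linear order on
  \<^typ>\<open>'b\<close>; such a monomial is encoded by the finite set \<open>{|b\<^sub>1, \<dots>, b\<^sub>k|}\<close>, the unit
  by the empty set. The exterior degree is the cardinality. Multiplying two monomials sorts the
  concatenation of their factors, whence the sign of the product.
\<close>

definition basis_order :: "('b \<times> 'b) set" where
  "basis_order = (SOME r. linear_order_on UNIV r)"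

definition basis_less :: "'b \<Rightarrow> 'b \<Rightarrow> bool"  (infix \<open>\<prec>\<close> 50) where
  "x \<prec> y \<longleftrightarrow> (x, y) \<in> basis_order \<and> x \<noteq> y"

type_synonym 'b ext = "'b fset \<Rightarrow>\<^sub>0 rat"

definition inversions :: "'b fset \<Rightarrow> 'b fset \<Rightarrow> ('b \<times> 'b) set" where
  "inversions S T = {(s, t). s |\<in>| S \<and> t |\<in>| T \<and> t \<prec> s}"

definition wedge_basis :: "'b fset \<Rightarrow> 'b fset \<Rightarrow> 'b ext" where
  "wedge_basis S T =
     (if S |\<inter>| T = {||} then scale ((-1) ^ card (inversions S T)) (basis (S |\<union>| T)) else 0)"

definition wedge :: "'b ext \<Rightarrow> 'b ext \<Rightarrow> 'b ext"  (infixl \<open>\<and>\<^sub>e\<close> 70) where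
  "f \<and>\<^sub>e g = lin_ext (\<lambda>S. lin_ext (\<lambda>T. wedge_basis S T) g) f"

definition gen :: "'b \<Rightarrow> 'b ext" where
  "gen b = basis {|b|}"

subsection \<open>Sanity checks: an associative unital algebra with anticommuting generators\<close>

lemma linear_order_basis_order: "linear_order_on UNIV (basis_order :: ('b \<times> 'b) set)"
proof -
  obtain r :: "('b \<times> 'b) set" where "well_order_on UNIV r"
    using well_order_on by blast
  then have "linear_order_on UNIV r"
    by (simp add: well_order_on_def)
  then show ?thesis
    unfolding basis_order_def by (rule someI)
qed

lemma basis_less_linear: "x \<noteq> y \<Longrightarrow> x \<prec> y \<or> y \<prec> x"
  using linear_order_basis_order
  by (fastforce simp: basis_less_def linear_order_on_def total_on_def)

lemma basis_less_asym: "x \<prec> y \<Longrightarrow> \<not> y \<prec> x"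
  using linear_order_basis_order
  by (auto simp: basis_less_def linear_order_on_def partial_order_on_def antisym_def)

lemma basis_less_trans: "x \<prec> y \<Longrightarrow> y \<prec> z \<Longrightarrow> x \<prec> z"
  using linear_order_basis_order basis_less_asym
  unfolding basis_less_def linear_order_on_def partial_order_on_def preorder_on_def
  by (metis transE)

lemma finite_inversions [simp]: "finite (inversions S T)"
  by (rule finite_subset[of _ "fset S \<times> fset T"]) (auto simp: inversions_def)

lemma card_inversions_union_left:
  assumes "S |\<inter>| T = {||}"
  shows "card (inversions (S |\<union>| T) U) = card (inversions S U) + card (inversions T U)"
proof -
  have "inversions (S |\<union>| T) U = inversions S U \<union> inversions T U"
    by (auto simp: inversions_def)
  moreover have "inversions S U \<inter> inversions T U = {}"
    using assms by (fastforce simp: inversions_def)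
  ultimately show ?thesis
    by (simp add: card_Un_disjoint)
qed

lemma card_inversions_union_right:
  assumes "T |\<inter>| U = {||}"
  shows "card (inversions S (T |\<union>| U)) = card (inversions S T) + card (inversions S U)"
proof -
  have "inversions S (T |\<union>| U) = inversions S T \<union> inversions S U"
    by (auto simp: inversions_def)
  moreover have "inversions S T \<inter> inversions S U = {}"
    using assms by (fastforce simp: inversions_def)
  ultimately show ?thesis
    by (simp add: card_Un_disjoint)
qed

lemma wedge_zero [simp]: "0 \<and>\<^sub>e g = 0" "f \<and>\<^sub>e 0 = 0"
  by (simp_all add: wedge_def lin_ext_def)

lemma wedge_add_left: "(f + f') \<and>\<^sub>e g = f \<and>\<^sub>e g + f' \<and>\<^sub>e g"
  by (simp add: wedge_def lin_ext_add)

lemma wedge_scale_left: "scale c f \<and>\<^sub>e g = scale c (f \<and>\<^sub>e g)"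
  by (simp add: wedge_def lin_ext_scale)

lemma wedge_add_right: "f \<and>\<^sub>e (g + g') = f \<and>\<^sub>e g + f \<and>\<^sub>e g'"
  by (simp add: wedge_def lin_ext_add) (simp add: lin_ext_def scale_add sum.distrib)

lemma wedge_scale_right: "f \<and>\<^sub>e scale c g = scale c (f \<and>\<^sub>e g)"
  by (simp add: wedge_def lin_ext_scale) (simp add: lin_ext_def scale_sum mult_ac)

lemma wedge_basis_basis [simp]: "basis S \<and>\<^sub>e basis T = wedge_basis S T"
  by (simp add: wedge_def)

lemma basis_induct [case_names zero add]:
  assumes "P 0" and "\<And>c x f. P f \<Longrightarrow> P (scale c (basis x) + f)"
  shows "P f"
proof -
  have "P (\<Sum>x\<in>A. scale (Poly_Mapping.lookup f x) (basis x))" if "finite A" for A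
    using that by induction (simp_all add: assms)
  moreover have "(\<Sum>x\<in>Poly_Mapping.keys f. scale (Poly_Mapping.lookup f x) (basis x)) = f"
    by (rule poly_mapping_eqI)
      (auto simp: lookup_sum basis_def lookup_single when_def in_keys_iff if_distrib cong: if_cong)
  ultimately show ?thesis
    using finite_keys by metis
qed

lemma wedge_assoc: "(f \<and>\<^sub>e g) \<and>\<^sub>e h = f \<and>\<^sub>e (g \<and>\<^sub>e h)"
proof -
  have bas: "(basis S \<and>\<^sub>e basis T) \<and>\<^sub>e basis U = basis S \<and>\<^sub>e (basis T \<and>\<^sub>e basis U)"
    for S T U :: "'a fset"
  proof (cases "S |\<inter>| T = {||} \<and> T |\<inter>| U = {||} \<and> S |\<inter>| U = {||}")
    case True
    then have "(S |\<union>| T) |\<inter>| U = {||}" "S |\<inter>| (T |\<union>| U) = {||}"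
      by auto
    with True show ?thesis
      by (simp add: wedge_basis_def wedge_scale_left wedge_scale_right power_add
          card_inversions_union_left card_inversions_union_right mult_ac sup_assoc)
  next
    case False
    then have "S |\<inter>| T \<noteq> {||} \<or> (S |\<union>| T) |\<inter>| U \<noteq> {||}"
      and "T |\<inter>| U \<noteq> {||} \<or> S |\<inter>| (T |\<union>| U) \<noteq> {||}"
      by auto
    then show ?thesis
      by (auto simp: wedge_basis_def wedge_scale_left wedge_scale_right)
  qed
  show ?thesis
  proof (induction f rule: basis_induct)
    case (add c x f)
    have "(basis x \<and>\<^sub>e g) \<and>\<^sub>e h = basis x \<and>\<^sub>e (g \<and>\<^sub>e h)"
    proof (induction g rule: basis_induct)
      case (add d y g)
      have "(basis x \<and>\<^sub>e basis y) \<and>\<^sub>e h = basis x \<and>\<^sub>e (basis y \<and>\<^sub>e h)"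
        by (induction h rule: basis_induct)
          (simp_all add: wedge_add_right wedge_scale_right bas del: wedge_basis_basis)
      with add show ?case
        by (simp add: wedge_add_left wedge_add_right wedge_scale_left wedge_scale_right
            del: wedge_basis_basis)
    qed simp
    with add show ?case
      by (simp add: wedge_add_left wedge_scale_left)
  qed simp
qed

lemma wedge_unit: "basis {||} \<and>\<^sub>e f = f" "f \<and>\<^sub>e basis {||} = f"
proof -
  have *: "wedge_basis {||} S = basis S" "wedge_basis S {||} = basis S" for S :: "'a fset"
    by (simp_all add: wedge_basis_def inversions_def)
  show "basis {||} \<and>\<^sub>e f = f"
    by (induction f rule: basis_induct) (simp_all add: wedge_add_right wedge_scale_right *)
  show "f \<and>\<^sub>e basis {||} = f"
    by (induction f rule: basis_induct) (simp_all add: wedge_add_left wedge_scale_left *)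
qed

lemma gen_wedge_self: "gen x \<and>\<^sub>e gen x = 0"
  by (simp add: gen_def wedge_basis_def)

lemma gen_wedge_anticommute: "gen x \<and>\<^sub>e gen y = - (gen y \<and>\<^sub>e gen x)"
proof (cases "x = y")
  case False
  have inv: "inversions {|a|} {|b|} = (if b \<prec> a then {(a, b)} else {})" for a b :: 'a
    by (auto simp: inversions_def)
  have "{|x|} |\<inter>| {|y|} = {||}" "{|y|} |\<inter>| {|x|} = {||}"
    using False by auto
  moreover have "(x \<prec> y \<and> \<not> y \<prec> x) \<or> (y \<prec> x \<and> \<not> x \<prec> y)"
    using False basis_less_linear basis_less_asym by metis
  ultimately show ?thesis
    by (auto simp: gen_def wedge_basis_def inv finsert_commute intro!: poly_mapping_eqI)
qed (simp add: gen_wedge_self)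

lemma wedge_sorted:
  assumes "\<And>s t. s |\<in>| S \<Longrightarrow> t |\<in>| T \<Longrightarrow> s \<prec> t"
  shows "basis S \<and>\<^sub>e basis T = basis (S |\<union>| T)"
proof -
  have "inversions S T = {}"
    using assms basis_less_asym by (fastforce simp: inversions_def)
  moreover have "S |\<inter>| T = {||}"
    using assms by (fastforce simp: basis_less_def)
  ultimately show ?thesis
    by (simp add: wedge_basis_def)
qed

section \<open>Decorated polygons and arrows\<close>

text \<open>
  The polygon \<open>[a\<^sub>1, \<dots>, a\<^sub>n\<^sub>+\<^sub>1]\<close> is the list of its decorations, starting after
  the root side and ending with it; the side \<open>a\<^sub>l\<close> has index \<^term>\<open>l - 1\<close> in the list.
\<close>

definition deco_polygons :: "'r set \<Rightarrow> 'r list set" where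
  "deco_polygons R = {p. 2 \<le> length p \<and> set p \<subseteq> R}"

definition weight :: "'r list \<Rightarrow> nat" where
  "weight p = length p - 1"

text \<open>The pair \<open>(k, l)\<close> is the arrow from \<open>v\<^sub>k\<close> to the side \<open>a\<^sub>l\<close>.\<close>

type_synonym arrow = "nat \<times> nat"

definition arrows :: "'r list \<Rightarrow> arrow set" where
  "arrows p = {0..weight p} \<times> {1..weight p + 1}"

text \<open>The endpoints of \<open>a\<^sub>l\<close> are \<open>v\<^sub>l\<^sub>-\<^sub>1\<close> and \<open>v\<^sub>l\<close>, with \<open>v\<^sub>n\<^sub>+\<^sub>1 = v\<^sub>0\<close>.\<close>

definition trivial_arrow :: "'r list \<Rightarrow> arrow \<Rightarrow> bool" where
  "trivial_arrow p = (\<lambda>(k, l). k = l - 1 \<or> k = l mod (weight p + 1))"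

definition nontrivial_arrows :: "'r list \<Rightarrow> arrow set" where
  "nontrivial_arrows p = {\<alpha> \<in> arrows p. \<not> trivial_arrow p \<alpha>}"

definition forward :: "arrow \<Rightarrow> bool" where
  "forward = (\<lambda>(k, l). k < l)"

definition arrow_sgn :: "arrow \<Rightarrow> rat" where
  "arrow_sgn \<alpha> = (case \<alpha> of (k, l) \<Rightarrow> if forward \<alpha> then 1 else (-1) ^ (k - l))"

definition root_part :: "'r list \<Rightarrow> arrow \<Rightarrow> 'r list" where
  "root_part p \<alpha> = (case \<alpha> of (k, l) \<Rightarrow>
     if forward \<alpha> then take k p @ drop (l - 1) p else take l p @ drop k p)"

definition cut_part :: "'r list \<Rightarrow> arrow \<Rightarrow> 'r list" where
  "cut_part p \<alpha> = (case \<alpha> of (k, l) \<Rightarrow>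
     if forward \<alpha> then drop k (take l p) else rev (drop (l - 1) (take k p)))"

text \<open>The differential, extended from generators to monomials by the graded Leibniz rule.\<close>

definition del_polygon :: "'r list \<Rightarrow> 'r list ext" where
  "del_polygon p = (\<Sum>\<alpha>\<in>nontrivial_arrows p.
     scale (arrow_sgn \<alpha>) (gen (root_part p \<alpha>) \<and>\<^sub>e gen (cut_part p \<alpha>)))"

definition del_basis :: "'r list fset \<Rightarrow> 'r list ext" where
  "del_basis S = (\<Sum>p\<in>fset S. scale ((-1) ^ fcard (ffilter (\<lambda>q. q \<prec> p) S))
     (basis (ffilter (\<lambda>q. q \<prec> p) S) \<and>\<^sub>e del_polygon p \<and>\<^sub>e basis (ffilter (\<lambda>q. p \<prec> q) S)))"

definition del :: "'r list ext \<Rightarrow> 'r list ext" where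
  "del = lin_ext del_basis"

lemma finite_nontrivial_arrows [simp]: "finite (nontrivial_arrows p)"
  by (simp add: nontrivial_arrows_def arrows_def)

lemma del_gen: "del (gen p) = del_polygon p"
proof -
  have "ffilter (\<lambda>q. q \<prec> p) {|p|} = {||}" "ffilter (\<lambda>q. p \<prec> q) {|p|} = {||}"
    by (auto simp: basis_less_def)
  then show ?thesis
    by (simp add: del_def gen_def del_basis_def wedge_unit fcard_fempty)
qed

section \<open>Dissections\<close>

text \<open>
  The boundary of the polygon is parametrised by \<open>[0, n + 1)\<close> with \<open>v\<^sub>k\<close> at \<open>k\<close>, so that the
  interior of \<open>a\<^sub>l\<close> is the open interval \<open>(l - 1, l)\<close>. Two segments joining boundary points
  \<open>a, b\<close> and \<open>c, d\<close> cross iff \<open>a, b\<close> separate \<open>c\<close> from \<open>d\<close>.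
\<close>

definition side :: "nat \<Rightarrow> real set" where
  "side l = {real l - 1 <..< real l}"

definition separates :: "real \<Rightarrow> real \<Rightarrow> real \<Rightarrow> real \<Rightarrow> bool" where
  "separates a b c d \<longleftrightarrow> min a b < c \<and> c < max a b \<and> (d < min a b \<or> max a b < d)"

definition cross :: "real \<Rightarrow> real \<Rightarrow> real \<Rightarrow> real \<Rightarrow> bool" where
  "cross a b c d \<longleftrightarrow> separates a b c d \<or> separates a b d c"

definition non_intersecting :: "arrow \<Rightarrow> arrow \<Rightarrow> bool" where
  "non_intersecting \<alpha> \<beta> \<longleftrightarrow> (\<exists>e\<in>side (snd \<alpha>). \<exists>e'\<in>side (snd \<beta>).
     e \<noteq> e' \<and> \<not> cross (real (fst \<alpha>)) e (real (fst \<beta>)) e')"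

text \<open>A dissection is given by its set of arrows; \<open>n - 1\<close> arrows give an \<open>n\<close>-fold dissection.\<close>

definition dissections :: "'r list \<Rightarrow> arrow set set" where
  "dissections p = {D. D \<subseteq> nontrivial_arrows p \<and> pairwise non_intersecting D}"

text \<open>
  The arrow \<open>\<alpha>\<close> with tip \<open>e\<close> cuts the boundary into two arcs. Of these, the interval between its
  starting point and \<open>e\<close> is the one away from the root region, since the latter contains the part
  of the root side that ends at \<open>v\<^sub>0\<close>.
\<close>

definition far_arc :: "arrow \<Rightarrow> real \<Rightarrow> real set" where
  "far_arc \<alpha> e = {min (real (fst \<alpha>)) e .. max (real (fst \<alpha>)) e}"

definition beyond :: "arrow \<Rightarrow> arrow \<Rightarrow> bool" where
  "beyond \<alpha> \<beta> \<longleftrightarrow> \<beta> \<noteq> \<alpha> \<and>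
     (\<exists>e\<in>side (snd \<alpha>). \<exists>e'\<in>side (snd \<beta>). far_arc \<beta> e' \<subseteq> far_arc \<alpha> e)"

text \<open>
  Every region but the root region has a unique boundary arrow closest to the root, and each arrow
  is that of exactly one region, namely the adjacent one on its far side. So \<^term>\<open>None\<close> stands for
  the root region and \<^term>\<open>Some \<alpha>\<close> for the region on the far side of \<open>\<alpha>\<close>.
\<close>

type_synonym region = "arrow option"

definition regions :: "arrow set \<Rightarrow> region set" where
  "regions D = insert None (Some ` D)"

definition arrows_beyond :: "arrow set \<Rightarrow> region \<Rightarrow> arrow set" where
  "arrows_beyond D r = (case r of None \<Rightarrow> D | Some \<alpha> \<Rightarrow> {\<beta> \<in> D. beyond \<alpha> \<beta>})"

text \<open>
  The boundary arrows of a region, apart from the one leading to the root, are the arrows beyond it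
  that are not hidden by another such arrow. Each of them is an edge of the dual tree, here directed
  away from the root.
\<close>

definition outer_arrows :: "arrow set \<Rightarrow> region \<Rightarrow> arrow set" where
  "outer_arrows D r =
     {\<beta> \<in> arrows_beyond D r. \<not> (\<exists>\<gamma>\<in>arrows_beyond D r. beyond \<gamma> \<beta>)}"

definition dual_tree :: "arrow set \<Rightarrow> (region \<times> region) set" where
  "dual_tree D = {(r, Some \<beta>) |r \<beta>. r \<in> regions D \<and> \<beta> \<in> outer_arrows D r}"

definition tree_order :: "arrow set \<Rightarrow> (region \<times> region) set" where
  "tree_order D = (dual_tree D)\<^sup>*"

text \<open>
  Contracting its boundary arrows, the sides of the region \<^term>\<open>Some \<alpha>\<close> are the sides meeting the
  far arc of \<open>\<alpha>\<close>, except those lying entirely on the far arc of another boundary arrow of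
  the region.
\<close>

definition sides_met :: "arrow \<Rightarrow> nat set" where
  "sides_met \<alpha> = (case \<alpha> of (k, l) \<Rightarrow> if forward \<alpha> then {k + 1..l} else {l..k})"

definition sides_covered :: "arrow \<Rightarrow> nat set" where
  "sides_covered \<alpha> = sides_met \<alpha> - {snd \<alpha>}"

definition region_sides :: "'r list \<Rightarrow> arrow set \<Rightarrow> region \<Rightarrow> nat set" where
  "region_sides p D r =
     (case r of None \<Rightarrow> {1..weight p + 1} | Some \<alpha> \<Rightarrow> sides_met \<alpha>)
       - (\<Union>\<beta>\<in>outer_arrows D r. sides_covered \<beta>)"

text \<open>
  The root side comes last: the side where \<open>\<alpha>\<close> ends has the largest index among the sides of
  \<^term>\<open>Some \<alpha>\<close> if \<open>\<alpha>\<close> is forward, and the smallest one if it is backward.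
\<close>

definition region_polygon :: "'r list \<Rightarrow> arrow set \<Rightarrow> region \<Rightarrow> 'r list" where
  "region_polygon p D r = map (\<lambda>l. p ! (l - 1))
     (let ls = sorted_list_of_set (region_sides p D r)
      in case r of None \<Rightarrow> ls | Some \<alpha> \<Rightarrow> if forward \<alpha> then ls else rev ls)"

definition dissection_sgn :: "'r list \<Rightarrow> arrow set \<Rightarrow> rat" where
  "dissection_sgn p D =
     (\<Prod>\<alpha> | \<alpha> \<in> D \<and> \<not> forward \<alpha>. (-1) ^ weight (region_polygon p D (Some \<alpha>)))"

definition compatible_orders :: "arrow set \<Rightarrow> region list set" where
  "compatible_orders D = {rs. distinct rs \<and> set rs = regions D \<and>
     sorted_wrt (\<lambda>r s. (s, r) \<notin> tree_order D) rs}"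

lemma finite_dissections [simp]: "finite (dissections p)"
  by (rule finite_subset[of _ "Pow (nontrivial_arrows p)"]) (auto simp: dissections_def)

lemma finite_compatible_orders:
  assumes "finite D"
  shows "finite (compatible_orders D)"
proof (rule finite_subset)
  show "compatible_orders D \<subseteq> {rs. set rs \<subseteq> regions D \<and> length rs = card (regions D)}"
    by (auto simp: compatible_orders_def) (metis distinct_card)
  show "finite {rs. set rs \<subseteq> regions D \<and> length rs = card (regions D)}"
    using assms by (intro finite_lists_length_eq) (simp add: regions_def)
qed

section \<open>The bar construction\<close>

text \<open>
  The augmentation ideal has the nonempty monomials as its basis, hence its tensor coalgebra has as
  its basis the words \<open>[x\<^sub>1|\<dots>|x\<^sub>N]\<close> in nonempty monomials.
\<close>

type_synonym 'b bar = "'b fset list \<Rightarrow>\<^sub>0 rat"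

definition word_degree :: "'b fset list \<Rightarrow> int" where
  "word_degree w = (\<Sum>x\<leftarrow>w. int (fcard x) - 1)"

definition bar_words :: "'r set \<Rightarrow> 'r list fset list set" where
  "bar_words R = {w. \<forall>x\<in>set w. x \<noteq> {||} \<and> fset x \<subseteq> deco_polygons R}"

definition bar_construction :: "'r set \<Rightarrow> int \<Rightarrow> 'r list bar set" where
  "bar_construction R d =
     {f. \<forall>w\<in>Poly_Mapping.keys f. w \<in> bar_words R \<and> word_degree w = d}"

text \<open>\<open>[u|y|v]\<close> for words \<open>u\<close>, \<open>v\<close> and an arbitrary element \<open>y\<close> of the exterior algebra.\<close>

definition bar_insert :: "'b fset list \<Rightarrow> 'b ext \<Rightarrow> 'b fset list \<Rightarrow> 'b bar" where
  "bar_insert u y v = lin_ext (\<lambda>x. basis (u @ [x] @ v)) y"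

text \<open>The letter \<open>x\<^sub>j\<close> of a word \<open>w\<close> is \<^term>\<open>w ! (j - 1)\<close>.\<close>

definition bar_D1 :: "'b bar \<Rightarrow> 'b bar" where
  "bar_D1 = lin_ext (\<lambda>w. - (\<Sum>j = 1..<length w.
     scale ((-1) powi word_degree (take j w))
       (bar_insert (take (j - 1) w) (basis (w ! (j - 1)) \<and>\<^sub>e basis (w ! j)) (drop (j + 1) w))))"

definition bar_D2 :: "'r list bar \<Rightarrow> 'r list bar" where
  "bar_D2 = lin_ext (\<lambda>w. \<Sum>j = 1..length w.
     scale ((-1) powi word_degree (take (j - 1) w))
       (bar_insert (take (j - 1) w) (del (basis (w ! (j - 1)))) (drop j w)))"

definition bar_cocycle :: "'r set \<Rightarrow> int \<Rightarrow> 'r list bar \<Rightarrow> bool" where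
  "bar_cocycle R d f \<longleftrightarrow> f \<in> bar_construction R d \<and> bar_D1 f + bar_D2 f = 0"

text \<open>An \<open>n\<close>-fold dissection contributes words of length \<open>n\<close>.\<close>

definition bar_element :: "'r list \<Rightarrow> 'r list bar" where
  "bar_element p = (\<Sum>D\<in>dissections p. scale (dissection_sgn p D)
     (\<Sum>rs\<in>compatible_orders D. basis (map (\<lambda>r. {|region_polygon p D r|}) rs)))"

end

theory Submission
  imports Defs
begin

text \<open>
  Mark the vertices and the sides of the polygon alternately on a circle with \<open>2n + 2\<close> points. Arrows
  become chords joining points of opposite parity, dissections become dissections of the
  \<open>(2n + 2)\<close>-gon into polygons with evenly many vertices, and each region is again such a polygon.

  In \<open>D\<^sub>1\<close>, two consecutive letters \<open>r\<close>, \<open>s\<close> that are not joined by an edge of the dual tree may be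
  swapped, and these terms cancel because \<open>r \<and> s = - s \<and> r\<close>. If they are joined by the arrow \<open>\<beta>\<close>,
  removing \<open>\<beta>\<close> from \<open>D\<close> merges both regions into one region of \<open>D - {\<beta>}\<close>, in whose polygon \<open>\<beta>\<close> is
  a non-trivial arrow. This is a bijection onto the pairs of a letter of a word of \<open>D - {\<beta>}\<close> and an
  arrow of that letter, hence onto the terms of \<open>D\<^sub>2\<close>, with opposite signs.
\<close>

section \<open>Arrows as chords\<close>

text \<open>The definitions place the tips of arrows in real intervals, existentially. The choice
  matters only for arrows ending on the same side, and these can always be drawn without crossing;
  hence one odd point per side is enough and all later geometry is about the integers
  \<open>lo\<close> and \<open>hi\<close>.

  The opposite signs rest on the weight being additive under cutting: both parts keep the side where
  the arrow ends, and the weight is the number of sides minus one. Let an arrow \<gamma> of the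
  polygon of the region \<open>r\<close> correspond to \<beta>. Because the polygon of a backward
  region runs against the orientation of the given one, \<beta> is forward iff \<gamma> and
  \<open>r\<close> have the same direction. In each of the four cases the sign of the dissection
  changes by \<open>arrow_sgn\<close> of \<gamma>. All letters have bar degree 0, so the only other
  sign is the minus in \<open>bar_D1\<close>.

  The bijection needs stable names: on inserting \<beta> the part nearer the root keeps the name
  \<open>r\<close>, the far part is \<open>Some \<beta>\<close>, and the word gains this letter
  right after \<open>r\<close>. That position is admissible because the far arcs containing that of
  \<beta> form a chain.\<close>

text \<open>The vertex \<open>v\<^sub>k\<close> is the point \<open>2k\<close> and the side \<open>a\<^sub>l\<close> is the point \<open>2l - 1\<close>.\<close>

definition lo :: "arrow \<Rightarrow> nat" where
  "lo \<alpha> = min (2 * fst \<alpha>) (2 * snd \<alpha> - 1)"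

definition hi :: "arrow \<Rightarrow> nat" where
  "hi \<alpha> = max (2 * fst \<alpha>) (2 * snd \<alpha> - 1)"

text \<open>Only strict interleaving counts, so chords may share an endpoint: arrows may have the
  same starting vertex or end on the same side.\<close>

definition noncrossing :: "arrow \<Rightarrow> arrow \<Rightarrow> bool" where
  "noncrossing \<alpha> \<beta> \<longleftrightarrow> \<not> (lo \<alpha> < lo \<beta> \<and> lo \<beta> < hi \<alpha> \<and> hi \<alpha> < hi \<beta>) \<and>
     \<not> (lo \<beta> < lo \<alpha> \<and> lo \<alpha> < hi \<beta> \<and> hi \<beta> < hi \<alpha>)"

text \<open>Writing the side as \<open>l + 1\<close> removes the truncated subtraction from
  \<open>lo\<close> and \<open>hi\<close>.\<close>

lemma lo_hi_cases:
  assumes "1 \<le> snd \<alpha>"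
  obtains (fwd) k l where "\<alpha> = (k, l + 1)" "k \<le> l" "lo \<alpha> = 2 * k" "hi \<alpha> = 2 * l + 1" "forward \<alpha>"
    | (bwd) k l where "\<alpha> = (k, l + 1)" "l < k" "lo \<alpha> = 2 * l + 1" "hi \<alpha> = 2 * k" "\<not> forward \<alpha>"
proof -
  obtain k l where "\<alpha> = (k, l + 1)"
    using assms by (metis add.commute le_Suc_ex prod.collapse)
  then show ?thesis
    using fwd[of k l] bwd[of k l] by (cases "k \<le> l") (auto simp: lo_def hi_def forward_def)
qed

lemma lo_less_hi: "1 \<le> snd \<alpha> \<Longrightarrow> lo \<alpha> < hi \<alpha>"
  by (erule lo_hi_cases) auto

lemma even_hi: "1 \<le> snd \<alpha> \<Longrightarrow> even (hi \<alpha>) \<longleftrightarrow> odd (lo \<alpha>)"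
  by (erule lo_hi_cases) auto

lemma forward_iff_even_lo: "1 \<le> snd \<alpha> \<Longrightarrow> forward \<alpha> \<longleftrightarrow> even (lo \<alpha>)"
  by (erule lo_hi_cases) auto

text \<open>The even endpoint is the starting vertex and the odd one the target side, so the
  undirected chord determines the arrow.\<close>

lemma lo_hi_inj:
  assumes "1 \<le> snd \<alpha>" "1 \<le> snd \<beta>" "lo \<alpha> = lo \<beta>" "hi \<alpha> = hi \<beta>"
  shows "\<alpha> = \<beta>"
  using assms(3,4) forward_iff_even_lo[OF assms(1)] forward_iff_even_lo[OF assms(2)]
  by (cases rule: lo_hi_cases[OF assms(1)]; cases rule: lo_hi_cases[OF assms(2)]) (auto, presburger+)

lemma cross_nat_iff:
  fixes a b c d :: nat
  assumes "a \<noteq> b" "c \<noteq> d" "a \<noteq> d" "b \<noteq> c" "b \<noteq> d"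
  shows "(((a < c \<and> c < b \<or> b < c \<and> c < a) \<and> (d < a \<and> d < b \<or> a < d \<and> b < d)) \<or>
    ((a < d \<and> d < b \<or> b < d \<and> d < a) \<and> (c < a \<and> c < b \<or> a < c \<and> b < c))) \<longleftrightarrow>
    (min a b < min c d \<and> min c d < max a b \<and> max a b < max c d) \<or>
    (min c d < min a b \<and> min a b < max c d \<and> max c d < max a b)"
  using assms
  by (cases a b rule: linorder_cases; cases c d rule: linorder_cases;  simp add: min_def max_def) linarith+

text \<open>A side and one of its endpoints are points at distance 1, and distance 2 is impossible
  by parity, whence the constant 3. The pair of 0 and \<open>2 * n + 1\<close> is \<open>v_0\<close>
  with the root side, which are adjacent around the circle.\<close>

lemma nontrivial_arrow_nat_iff:
  fixes k l n :: nat
  shows "k \<le> n \<and> 1 \<le> l \<and> l \<le> n + 1 \<and> \<not> (k = l - 1 \<or> k = (if l = n + 1 then 0 else l)) \<longleftrightarrow> 1 \<le> l \<and> min (2 * k) (2 * l - 1) + 3 \<le> max (2 * k) (2 * l - 1) \<and>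
    max (2 * k) (2 * l - 1) \<le> 2 * n + 1 \<and> \<not> (min (2 * k) (2 * l - 1) = 0 \<and> max (2 * k) (2 * l - 1) = 2 * n + 1)"
  by (cases "k < l") (auto simp: min_def max_def split: if_splits)
lemma nontrivial_arrows_iff:
  "\<alpha> \<in> nontrivial_arrows p \<longleftrightarrow> 1 \<le> snd \<alpha> \<and> lo \<alpha> + 3 \<le> hi \<alpha> \<and> hi \<alpha> \<le> 2 * weight p + 1 \<and>
     \<not> (lo \<alpha> = 0 \<and> hi \<alpha> = 2 * weight p + 1)"
proof -
  obtain k l where [simp]: "\<alpha> = (k, l)" by fastforce
  define n where "n = weight p"
  have "l \<le> n + 1 \<Longrightarrow> l mod (n + 1) = (if l = n + 1 then 0 else l)" by simp
  then have "k \<le> n \<and> 1 \<le> l \<and> l \<le> n + 1 \<and> \<not> (k = l - 1 \<or> k = l mod (n + 1)) \<longleftrightarrow>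
    k \<le> n \<and> 1 \<le> l \<and> l \<le> n + 1 \<and> \<not> (k = l - 1 \<or> k = (if l = n + 1 then 0 else l))"
    by auto
  also have "\<dots> \<longleftrightarrow> 1 \<le> l \<and> min (2 * k) (2 * l - 1) + 3 \<le> max (2 * k) (2 * l - 1) \<and>
    max (2 * k) (2 * l - 1) \<le> 2 * n + 1 \<and> \<not> (min (2 * k) (2 * l - 1) = 0 \<and> max (2 * k) (2 * l - 1) = 2 * n + 1)"
    by (rule nontrivial_arrow_nat_iff)
  finally show ?thesis
    by (auto simp: nontrivial_arrows_def arrows_def trivial_arrow_def lo_def hi_def n_def)
qed

lemma separates_iff:
  "separates a b c d \<longleftrightarrow> (a < c \<and> c < b \<or> b < c \<and> c < a) \<and> (d < a \<and> d < b \<or> a < d \<and> b < d)"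
  by (auto simp: separates_def min_def max_def)

text \<open>Wherever the tip sits in the open side, it compares with vertices as the odd point of
  that side does.\<close>

lemma side_less_iff:
  assumes "e \<in> side l" "1 \<le> l"
  shows "real k < e \<longleftrightarrow> 2 * k < 2 * l - 1" "e < real k \<longleftrightarrow> 2 * l - 1 < 2 * k"
proof -
  obtain m where "l = m + 1"
    using assms(2) by (metis add.commute le_Suc_ex)
  then show "real k < e \<longleftrightarrow> 2 * k < 2 * l - 1" "e < real k \<longleftrightarrow> 2 * l - 1 < 2 * k"
    using assms(1) by (cases "k \<le> m"; auto simp: side_def)+
qed

lemma side_no_vertex: "e \<in> side l \<Longrightarrow> 1 \<le> l \<Longrightarrow> real k \<noteq> e"
  using side_less_iff[of e l k] by (cases "k < l") auto

lemma beyond_iff: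
  assumes "1 \<le> snd \<alpha>" "1 \<le> snd \<beta>"
  shows "beyond \<alpha> \<beta> \<longleftrightarrow> \<beta> \<noteq> \<alpha> \<and> lo \<alpha> \<le> lo \<beta> \<and> hi \<beta> \<le> hi \<alpha>"
proof -
  obtain k l k' l' where [simp]: "\<alpha> = (k, l)" "\<beta> = (k', l')" by fastforce
  have l: "1 \<le> l" "1 \<le> l'" using assms by auto
  define P where "P e e' \<longleftrightarrow> min (real k) e \<le> min (real k') e' \<and> max (real k') e' \<le> max (real k) e"
    for e e'
  have far: "far_arc (k', l') e' \<subseteq> far_arc (k, l) e \<longleftrightarrow> P e e'" for e e'
    by (auto simp: far_arc_def P_def)
  show ?thesis
  proof (intro iffI conjI)
    assume b: "beyond \<alpha> \<beta>"
    then show "\<beta> \<noteq> \<alpha>" by (simp add: beyond_def)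
    from b obtain e e' where e: "e \<in> side l" "e' \<in> side l'" "P e e'"
      by (auto simp: beyond_def far)
    have i: "real l - 1 < e" "e < real l" "real l' - 1 < e'" "e' < real l'"
      using e by (auto simp: side_def)
    have dbl: "2 * m < 2 * n - 1 \<longleftrightarrow> m < n" for m n :: nat by linarith
    have *: "real k < e \<longleftrightarrow> k < l" "real k' < e' \<longleftrightarrow> k' < l'" "real k < e' \<longleftrightarrow> k < l'" "real k' < e \<longleftrightarrow> k' < l"
      "k \<noteq> e" "k' \<noteq> e'" "k' \<noteq> e" "k \<noteq> e'"
      using side_no_vertex[OF e(1) l(1)] side_no_vertex[OF e(2) l(2)]
        side_less_iff(1)[OF e(1) l(1)] side_less_iff(1)[OF e(2) l(2)] dbl
      by auto
    have **: "e \<le> e' \<Longrightarrow> l \<le> l'" "e' \<le> e \<Longrightarrow> l' \<le> l" using i by linarith+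
    have "min (real k) e \<le> min (real k') e'" "max (real k') e' \<le> max (real k) e"
      using e by (auto simp: P_def)
    then show "lo \<alpha> \<le> lo \<beta>" "hi \<beta> \<le> hi \<alpha>"
      using * ** l unfolding lo_def hi_def fst_conv snd_conv \<open>\<alpha> = _\<close> \<open>\<beta> = _\<close>
      by (auto simp: min_def max_def split: if_splits)
  next
    assume r: "\<beta> \<noteq> \<alpha> \<and> lo \<alpha> \<le> lo \<beta> \<and> hi \<beta> \<le> hi \<alpha>"
    \<comment> \<open>If both arrows end on the same side, the arc of \<alpha> must be the larger
      one: its tip is pushed past the midpoint, away from its starting vertex, while \<beta> ends in
      the midpoint.\<close>
    define e e' where "e = real l - (if k < l then 1/4 else 3/4)" and "e' = real l' - 1/2"
    have s: "e \<in> side l" "e' \<in> side l'" by (auto simp: e_def e'_def side_def)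
    have "P e e'"
      using r l
      by (auto simp: P_def e_def e'_def lo_def hi_def min_def max_def split: if_splits)
    then have "far_arc (k', l') e' \<subseteq> far_arc (k, l) e" by (simp add: far)
    then show "beyond \<alpha> \<beta>"
      unfolding beyond_def using s r by (simp, blast)
  qed
qed

lemma non_intersecting_iff:
  assumes "1 \<le> snd \<alpha>" "1 \<le> snd \<beta>"
  shows "non_intersecting \<alpha> \<beta> \<longleftrightarrow> noncrossing \<alpha> \<beta>"
proof -
  obtain k l k' l' where [simp]: "\<alpha> = (k, l)" "\<beta> = (k', l')" by fastforce
  have l: "1 \<le> l" "1 \<le> l'" using assms by auto
  define P where "P e e' \<longleftrightarrow> cross (real k) e (real k') e'" for e e'
  have ni: "non_intersecting \<alpha> \<beta> \<longleftrightarrow> (\<exists>e\<in>side l. \<exists>e'\<in>side l'. e \<noteq> e' \<and> \<not> P e e')"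
    by (simp add: non_intersecting_def P_def)
  have *: "real k < e \<longleftrightarrow> 2 * k < 2 * l - 1" "real k' < e' \<longleftrightarrow> 2 * k' < 2 * l' - 1"
     "real k < e' \<longleftrightarrow> 2 * k < 2 * l' - 1" "real k' < e \<longleftrightarrow> 2 * k' < 2 * l - 1"
     "e < real k \<longleftrightarrow> 2 * l - 1 < 2 * k" "e' < real k' \<longleftrightarrow> 2 * l' - 1 < 2 * k'"
     "e' < real k \<longleftrightarrow> 2 * l' - 1 < 2 * k" "e < real k' \<longleftrightarrow> 2 * l - 1 < 2 * k'"
     "real k < real k' \<longleftrightarrow> 2 * k < 2 * k'" "real k' < real k \<longleftrightarrow> 2 * k' < 2 * k"
     if "e \<in> side l" "e' \<in> side l'" for e e'
    using side_less_iff[OF that(1) l(1)] side_less_iff[OF that(2) l(2)] by auto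
  show ?thesis
  proof (cases "l = l'")
    case False
    have **: "e < e' \<longleftrightarrow> 2 * l - 1 < 2 * l' - 1" "e' < e \<longleftrightarrow> 2 * l' - 1 < 2 * l - 1" "e \<noteq> e'"
      if "e \<in> side l" "e' \<in> side l'" for e e'
      using that l False by (auto simp: side_def)
    have "P e e' \<longleftrightarrow> \<not> noncrossing \<alpha> \<beta>" if "e \<in> side l" "e' \<in> side l'" for e e'
    proof -
      have "2 * k \<noteq> 2 * l - 1" "2 * k' \<noteq> 2 * l' - 1" "2 * k \<noteq> 2 * l' - 1" "2 * l - 1 \<noteq> 2 * k'" "2 * l - 1 \<noteq> 2 * l' - 1"
        using l False by presburger+
      from cross_nat_iff[OF this] show ?thesis
        unfolding P_def cross_def separates_iff *[OF that] **[OF that] noncrossing_def lo_def hi_def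
          \<open>\<alpha> = _\<close> \<open>\<beta> = _\<close> fst_conv snd_conv
        by blast
    qed
    moreover have "real l - 1/2 \<in> side l" "real l' - 1/2 \<in> side l'" by (auto simp: side_def)
    ultimately show ?thesis unfolding ni using **(3) by blast
  next
    case True
    \<comment> \<open>The tips sit at one and three quarters of the common side. The sign of
      \<open>d\<close> makes the arcs nested if both vertices lie on the same side of the target,
      and disjoint otherwise.\<close>
    define d :: real where "d = (if k < k' \<longleftrightarrow> (k < l \<longleftrightarrow> k' < l) then 1/4 else -1/4)"
    have s: "real l - 1/2 + d \<in> side l" "real l - 1/2 - d \<in> side l" by (auto simp: side_def d_def)
    have "\<not> P (real l - 1/2 + d) (real l - 1/2 - d)"
      unfolding P_def cross_def separates_iff d_def by auto
    moreover have "real l - 1/2 + d \<noteq> real l - 1/2 - d" by (simp add: d_def)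
    ultimately have "non_intersecting \<alpha> \<beta>" unfolding ni using s True by blast
    moreover have "noncrossing \<alpha> \<beta>"
      using True l by (auto simp: noncrossing_def lo_def hi_def min_def max_def)
    ultimately show ?thesis by simp
  qed
qed

lemma dissections_iff:
  "D \<in> dissections p \<longleftrightarrow> D \<subseteq> nontrivial_arrows p \<and> (\<forall>\<alpha>\<in>D. \<forall>\<beta>\<in>D. noncrossing \<alpha> \<beta>)"
proof -
  have "noncrossing \<alpha> \<alpha>" for \<alpha> by (simp add: noncrossing_def)
  then show ?thesis
    unfolding dissections_def pairwise_def
    by (auto simp: subset_iff nontrivial_arrows_iff non_intersecting_iff)
      (metis non_intersecting_iff snd_conv One_nat_def)+
qed

section \<open>The order on the regions\<close>

text \<open>Keeps quantified arrows whole, since the facts below speak of \<open>lo\<close> and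
  \<open>hi\<close> rather than of components.\<close>

declare split_paired_All [simp del] split_paired_Ex [simp del]

lemma dissectionD:
  assumes "D \<in> dissections p" "\<alpha> \<in> D"
  shows "1 \<le> snd \<alpha>" "lo \<alpha> + 3 \<le> hi \<alpha>" "hi \<alpha> \<le> 2 * weight p + 1"
    "\<not> (lo \<alpha> = 0 \<and> hi \<alpha> = 2 * weight p + 1)" "\<beta> \<in> D \<Longrightarrow> noncrossing \<alpha> \<beta>"
  using assms by (auto simp: dissections_iff nontrivial_arrows_iff subset_iff)

lemma finite_dissection: "D \<in> dissections p \<Longrightarrow> finite D"
  by (metis dissections_iff finite_nontrivial_arrows finite_subset)

lemma beyond_trans:
  assumes "1 \<le> snd \<alpha>" "1 \<le> snd \<beta>" "1 \<le> snd \<gamma>" "beyond \<alpha> \<beta>" "beyond \<beta> \<gamma>"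
  shows "beyond \<alpha> \<gamma>"
  using assms by (auto simp: beyond_iff intro: lo_hi_inj)

text \<open>The extent \<open>hi - lo\<close> serves as the measure for choosing outermost or
  innermost arrows.\<close>

lemma beyond_size:
  assumes "1 \<le> snd \<alpha>" "1 \<le> snd \<beta>" "beyond \<alpha> \<beta>"
  shows "hi \<beta> - lo \<beta> < hi \<alpha> - lo \<alpha>"
proof -
  have "lo \<alpha> \<le> lo \<beta>" "hi \<beta> \<le> hi \<alpha>" "\<alpha> \<noteq> \<beta>"
    using assms by (auto simp: beyond_iff)
  moreover have "lo \<alpha> \<noteq> lo \<beta> \<or> hi \<alpha> \<noteq> hi \<beta>"
    using lo_hi_inj assms calculation by metis
  ultimately show ?thesis using lo_less_hi[OF assms(2)] by linarith
qed

text \<open>Proper containment of far arcs, with the root region below all others. On the regions of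
  a dissection it is the strict tree order, see \<open>tree_order_iff\<close>.\<close>

definition region_lt :: "region \<Rightarrow> region \<Rightarrow> bool" where
  "region_lt r s \<longleftrightarrow> (case s of None \<Rightarrow> False | Some \<beta> \<Rightarrow>
     (case r of None \<Rightarrow> True | Some \<alpha> \<Rightarrow> beyond \<alpha> \<beta>))"

lemma region_lt_simps [simp]:
  "\<not> region_lt r None" "region_lt None (Some \<beta>)" "region_lt (Some \<alpha>) (Some \<beta>) \<longleftrightarrow> beyond \<alpha> \<beta>"
  by (simp_all add: region_lt_def)

lemma arrows_beyond_eq: "arrows_beyond D r = {\<beta> \<in> D. region_lt r (Some \<beta>)}"
  by (cases r) (auto simp: arrows_beyond_def)

lemma regions_simps [simp]: "None \<in> regions D" "Some \<alpha> \<in> regions D \<longleftrightarrow> \<alpha> \<in> D"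
  by (auto simp: regions_def)

lemma region_lt_trans:
  assumes "D \<in> dissections p" "r \<in> regions D" "s \<in> regions D" "t \<in> regions D"
    "region_lt r s" "region_lt s t"
  shows "region_lt r t"
  using assms(2-) dissectionD(1)[OF assms(1)]
  by (cases r; cases s; cases t; simp) (metis One_nat_def beyond_trans)

lemma region_lt_irrefl: "\<not> region_lt r r"
  by (cases r) (auto simp: beyond_def)

lemma region_lt_asym:
  assumes "D \<in> dissections p" "r \<in> regions D" "s \<in> regions D" "region_lt r s"
  shows "\<not> region_lt s r"
  using region_lt_trans[OF assms(1,2,3,2,4)] region_lt_irrefl by blast

text \<open>Among the arrows beyond \<open>r\<close> that enclose \<beta>, one of greatest extent
  cannot be hidden: the arrow hiding it would also enclose \<beta> and be longer.\<close>

lemma outer_arrows_exists: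
  assumes D: "D \<in> dissections p" and \<beta>: "\<beta> \<in> arrows_beyond D r"
  obtains \<gamma> where "\<gamma> \<in> outer_arrows D r" "lo \<gamma> \<le> lo \<beta>" "hi \<beta> \<le> hi \<gamma>"
proof -
  let ?P = "\<lambda>\<gamma>. \<gamma> \<in> arrows_beyond D r \<and> lo \<gamma> \<le> lo \<beta> \<and> hi \<beta> \<le> hi \<gamma>"
  have "\<forall>\<gamma>. ?P \<gamma> \<longrightarrow> hi \<gamma> - lo \<gamma> < 2 * weight p + 2"
    using dissectionD(3)[OF D] by (fastforce simp: arrows_beyond_eq)
  with \<beta> obtain \<gamma> where \<gamma>: "?P \<gamma>" and m: "\<And>\<delta>. ?P \<delta> \<Longrightarrow> hi \<delta> - lo \<delta> \<le> hi \<gamma> - lo \<gamma>"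
    using ex_has_greatest_nat[of ?P \<beta> "\<lambda>\<gamma>. hi \<gamma> - lo \<gamma>" "2 * weight p + 2"] by blast
  have "\<not> beyond \<delta> \<gamma>" if \<delta>: "\<delta> \<in> arrows_beyond D r" for \<delta>
  proof
    assume b: "beyond \<delta> \<gamma>"
    have s: "1 \<le> snd \<delta>" "1 \<le> snd \<gamma>"
      using \<delta> \<gamma> dissectionD(1)[OF D] by (auto simp: arrows_beyond_eq)
    have "lo \<delta> \<le> lo \<gamma>" "hi \<gamma> \<le> hi \<delta>" using b s by (auto simp: beyond_iff)
    then have "hi \<delta> - lo \<delta> \<le> hi \<gamma> - lo \<gamma>" using m[of \<delta>] \<delta> \<gamma> by simp
    then show False using beyond_size[OF s b] by simp
  qed
  with \<gamma> show ?thesis by (intro that[of \<gamma>]) (auto simp: outer_arrows_def)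
qed

lemma dual_tree_region_lt: "(r, s) \<in> dual_tree D \<Longrightarrow> r \<in> regions D \<and> s \<in> regions D \<and> region_lt r s"
  by (auto simp: dual_tree_def outer_arrows_def arrows_beyond_eq)

text \<open>Edges increase \<open>region_lt\<close>, which is transitive. Conversely, the path from
  \<open>r\<close> to \<beta> is built from its end: its last edge comes from the innermost arrow
  between the two.\<close>

lemma tree_order_iff:
  assumes D: "D \<in> dissections p" and r: "r \<in> regions D"
  shows "(r, s) \<in> tree_order D \<longleftrightarrow> r = s \<or> s \<in> regions D \<and> region_lt r s"
proof
  assume "(r, s) \<in> tree_order D"
  then have "(r, s) \<in> (dual_tree D)\<^sup>*" by (simp add: tree_order_def)
  then show "r = s \<or> s \<in> regions D \<and> region_lt r s"
  proof (induction rule: rtrancl_induct)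
    case (step y z)
    then show ?case
      using dual_tree_region_lt[OF step(2)] region_lt_trans[OF D r] by blast
  qed simp
next
  assume "r = s \<or> s \<in> regions D \<and> region_lt r s"
  then show "(r, s) \<in> tree_order D"
  proof
    assume s: "s \<in> regions D \<and> region_lt r s"
    then obtain \<beta> where \<beta>: "s = Some \<beta>" "\<beta> \<in> D" by (cases s) auto
    have "\<beta> \<in> D \<Longrightarrow> region_lt r (Some \<beta>) \<Longrightarrow> (r, Some \<beta>) \<in> (dual_tree D)\<^sup>*"
    \<comment> \<open>The predecessor \<gamma> of \<beta> has a longer chord, so the defect of the
      extent against its upper bound decreases.\<close>
    proof (induction "2 * weight p + 1 - (hi \<beta> - lo \<beta>)" arbitrary: \<beta> rule: less_induct)
      case less
      show ?case
      proof (cases "\<beta> \<in> outer_arrows D r")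
        case True
        then have "(r, Some \<beta>) \<in> dual_tree D" using r by (auto simp: dual_tree_def)
        then show ?thesis by blast
      next
        case False
        let ?P = "\<lambda>\<gamma>. \<gamma> \<in> D \<and> region_lt r (Some \<gamma>) \<and> beyond \<gamma> \<beta>"
        from False less.prems obtain \<gamma>0 where "?P \<gamma>0"
          by (auto simp: outer_arrows_def arrows_beyond_eq)
        \<comment> \<open>By minimal extent no arrow lies between \<gamma> and \<beta>, hence
          \<beta> is an outer arrow of \<open>Some \<gamma>\<close>.\<close>
        then obtain \<gamma> where \<gamma>: "?P \<gamma>" and m: "\<And>\<delta>. ?P \<delta> \<Longrightarrow> hi \<gamma> - lo \<gamma> \<le> hi \<delta> - lo \<delta>"
          using ex_has_least_nat[of ?P \<gamma>0 "\<lambda>\<gamma>. hi \<gamma> - lo \<gamma>"] by auto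
        have "\<not> beyond \<delta> \<beta>" if \<delta>: "\<delta> \<in> D" "beyond \<gamma> \<delta>" for \<delta>
        proof
          assume "beyond \<delta> \<beta>"
          moreover have "region_lt r (Some \<delta>)"
            using region_lt_trans[OF D r, of "Some \<gamma>" "Some \<delta>"] \<gamma> \<delta> by auto
          ultimately have "hi \<gamma> - lo \<gamma> \<le> hi \<delta> - lo \<delta>" using m \<delta> by blast
          moreover have "hi \<delta> - lo \<delta> < hi \<gamma> - lo \<gamma>"
            using beyond_size \<delta> \<gamma> dissectionD(1)[OF D] by blast
          ultimately show False by simp
        qed
        then have "\<beta> \<in> outer_arrows D (Some \<gamma>)"
          using \<gamma> less.prems by (auto simp: outer_arrows_def arrows_beyond_eq)
        then have "(Some \<gamma>, Some \<beta>) \<in> dual_tree D" using \<gamma> by (auto simp: dual_tree_def)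
        moreover have "hi \<beta> - lo \<beta> < hi \<gamma> - lo \<gamma>"
          using beyond_size \<gamma> less.prems dissectionD(1)[OF D] by blast
        moreover have "hi \<gamma> \<le> 2 * weight p + 1" using \<gamma> dissectionD(3)[OF D] by blast
        ultimately show ?thesis
          using rtrancl.rtrancl_into_rtrancl[OF less.hyps[of \<gamma>]] \<gamma> by auto
      qed
    qed
    with s \<beta> show ?thesis by (simp add: tree_order_def)
  qed (simp add: tree_order_def)
qed

text \<open>
  In contrast to the dual tree, \<^const>\<open>region_lt\<close> does not depend on the dissection, so removing an
  arrow just restricts the order.
\<close>

lemma compatible_orders_iff:
  assumes D: "D \<in> dissections p"
  shows "rs \<in> compatible_orders D \<longleftrightarrow>
    distinct rs \<and> set rs = regions D \<and> sorted_wrt (\<lambda>r s. \<not> region_lt s r) rs"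
proof -
  have "sorted_wrt (\<lambda>r s. (s, r) \<notin> tree_order D) rs \<longleftrightarrow> sorted_wrt (\<lambda>r s. \<not> region_lt s r) rs"
    if "distinct rs" "set rs = regions D"
  proof -
    have "(rs ! j, rs ! i) \<in> tree_order D \<longleftrightarrow> region_lt (rs ! j) (rs ! i)"
      if "i < j" "j < length rs" for i j
    proof -
      have "rs ! j \<in> regions D" "rs ! i \<in> regions D" "rs ! j \<noteq> rs ! i"
        using that \<open>distinct rs\<close> \<open>set rs = regions D\<close>[symmetric] nth_eq_iff_index_eq[of rs j i] by simp_all
      then show ?thesis by (simp add: tree_order_iff[OF D])
    qed
    then show ?thesis unfolding sorted_wrt_iff_nth_less by blast
  qed
  then show ?thesis unfolding compatible_orders_def by blast
qed

section \<open>Regions as polygons with vertices among the marked points\<close>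

text \<open>The root region is treated as the far side of a fictitious forward chord, the trivial
  one from \<open>v_0\<close> to the root side. Together with \<open>region_hi\<close> and
  \<open>region_forward\<close> this mostly spares a separate treatment of it.\<close>

definition region_lo :: "region \<Rightarrow> nat" where
  "region_lo r = (case r of None \<Rightarrow> 0 | Some \<alpha> \<Rightarrow> lo \<alpha>)"

definition region_hi :: "'r list \<Rightarrow> region \<Rightarrow> nat" where
  "region_hi p r = (case r of None \<Rightarrow> 2 * weight p + 1 | Some \<alpha> \<Rightarrow> hi \<alpha>)"

text \<open>The vertices of the region in the \<open>(2n + 2)\<close>-gon.\<close>

definition region_points :: "'r list \<Rightarrow> arrow set \<Rightarrow> region \<Rightarrow> nat set" where
  "region_points p D r = {x. region_lo r \<le> x \<and> x \<le> region_hi p r \<and>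
     (\<forall>\<beta>\<in>arrows_beyond D r. \<not> (lo \<beta> < x \<and> x < hi \<beta>))}"

definition region_forward :: "region \<Rightarrow> bool" where
  "region_forward r = (case r of None \<Rightarrow> True | Some \<alpha> \<Rightarrow> forward \<alpha>)"

text \<open>
  The path runs from the first vertex to the root side of the region; as the first vertex is even and
  the parity alternates, indices in the path are again coordinates \<open>2k\<close>, \<open>2l - 1\<close> for the
  polygon of the region.
\<close>

definition region_path :: "'r list \<Rightarrow> arrow set \<Rightarrow> region \<Rightarrow> nat list" where
  "region_path p D r = (let ws = sorted_list_of_set (region_points p D r)
     in if region_forward r then ws else rev ws)"

text \<open>For the side \<open>a_l\<close> the point is \<open>x = 2 * l - 1\<close>, and
  \<open>x div 2 = l - 1\<close> is its list index.\<close>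

definition odd_sides :: "'r list \<Rightarrow> nat list \<Rightarrow> 'r list" where
  "odd_sides p xs = map (\<lambda>x. p ! (x div 2)) (filter odd xs)"

lemma odd_sides_rev: "odd_sides p (rev xs) = rev (odd_sides p xs)"
  by (simp add: odd_sides_def rev_map rev_filter)

lemma sides_met_iff: "1 \<le> snd \<beta> \<Longrightarrow> l \<in> sides_met \<beta> \<longleftrightarrow> 1 \<le> l \<and> lo \<beta> \<le> 2 * l - 1 \<and> 2 * l - 1 \<le> hi \<beta>"
  by (erule lo_hi_cases) (auto simp: sides_met_def)

text \<open>The inequalities are strict because the side where \<beta> ends is cut in two and
  survives in both adjacent regions.\<close>

lemma sides_covered_iff: "1 \<le> snd \<beta> \<Longrightarrow> l \<in> sides_covered \<beta> \<longleftrightarrow> 1 \<le> l \<and> lo \<beta> < 2 * l - 1 \<and> 2 * l - 1 < hi \<beta>"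
  by (erule lo_hi_cases) (auto simp: sides_covered_def sides_met_def)

lemma finite_region_points [simp]: "finite (region_points p D r)"
  by (rule finite_subset[of _ "{..region_hi p r}"]) (auto simp: region_points_def)

text \<open>\<open>region_sides\<close> removes what outer arrows cover,
  \<open>region_points\<close> what any arrow beyond \<open>r\<close> covers. By
  \<open>outer_arrows_exists\<close> both remove the same sides.\<close>

lemma region_sides_iff:
  assumes D: "D \<in> dissections p" and r: "r \<in> regions D"
  shows "l \<in> region_sides p D r \<longleftrightarrow> 1 \<le> l \<and> 2 * l - 1 \<in> region_points p D r"
proof -
  have "l \<in> (case r of None \<Rightarrow> {1..weight p + 1} | Some \<alpha> \<Rightarrow> sides_met \<alpha>) \<longleftrightarrow>
    1 \<le> l \<and> region_lo r \<le> 2 * l - 1 \<and> 2 * l - 1 \<le> region_hi p r"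
    using r dissectionD(1)[OF D]
    by (cases r) (auto simp: region_lo_def region_hi_def sides_met_iff)
  moreover have "(\<exists>\<beta>\<in>outer_arrows D r. l \<in> sides_covered \<beta>) \<longleftrightarrow>
    (\<exists>\<beta>\<in>arrows_beyond D r. lo \<beta> < 2 * l - 1 \<and> 2 * l - 1 < hi \<beta>)" (is "?L \<longleftrightarrow> ?R") if "1 \<le> l"
  proof
    assume ?L
    then obtain \<beta> where "\<beta> \<in> outer_arrows D r" "l \<in> sides_covered \<beta>" by blast
    moreover from this have "\<beta> \<in> arrows_beyond D r" "\<beta> \<in> D"
      by (auto simp: outer_arrows_def arrows_beyond_eq)
    ultimately show ?R using dissectionD(1)[OF D] sides_covered_iff by blast
  next
    assume ?R
    then obtain \<beta> where \<beta>: "\<beta> \<in> arrows_beyond D r" "lo \<beta> < 2 * l - 1" "2 * l - 1 < hi \<beta>" by blast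
    from outer_arrows_exists[OF D \<beta>(1)] obtain \<gamma>
      where \<gamma>: "\<gamma> \<in> outer_arrows D r" "lo \<gamma> \<le> lo \<beta>" "hi \<beta> \<le> hi \<gamma>" .
    then have "\<gamma> \<in> D" by (auto simp: outer_arrows_def arrows_beyond_eq)
    then have "l \<in> sides_covered \<gamma>"
      using \<beta> \<gamma> that dissectionD(1)[OF D] by (subst sides_covered_iff) auto
    then show ?L using \<gamma> by blast
  qed
  ultimately show ?thesis
    unfolding region_sides_def region_points_def by auto
qed

lemma region_polygon_eq:
  assumes D: "D \<in> dissections p" and r: "r \<in> regions D"
  shows "region_polygon p D r = odd_sides p (region_path p D r)"
proof -
  let ?ws = "sorted_list_of_set (region_points p D r)"
  \<comment> \<open>The odd point \<open>2 * l - 1\<close> is turned back into the side number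
    \<open>l\<close>; this is monotone, so the list stays strictly sorted.\<close>
  let ?us = "map (\<lambda>x. (x + 1) div 2) (filter odd ?ws)"
  have "set ?us = region_sides p D r"
  proof (intro equalityI subsetI)
    fix l assume "l \<in> region_sides p D r"
    then have "1 \<le> l" "2 * l - 1 \<in> region_points p D r"
      using region_sides_iff[OF D r] by auto
    moreover have "odd (2 * l - 1)" "(2 * l - 1 + 1) div 2 = l" using \<open>1 \<le> l\<close> by auto
    ultimately have "2 * l - 1 \<in> set (filter odd ?ws)" by simp
    then have "(2 * l - 1 + 1) div 2 \<in> set ?us" unfolding set_map by (rule imageI)
    then show "l \<in> set ?us" using \<open>(2 * l - 1 + 1) div 2 = l\<close> by simp
  next
    fix l assume "l \<in> set ?us"
    then obtain x where "x \<in> region_points p D r" "odd x" "l = (x + 1) div 2" by auto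
    moreover from \<open>odd x\<close> obtain m where "x = 2 * m + 1" by (rule oddE)
    ultimately show "l \<in> region_sides p D r" by (simp add: region_sides_iff[OF D r])
  qed
  moreover have "sorted_wrt (<) ?us"
  proof -
    have "sorted_wrt (<) (filter odd ?ws)"
      by (intro sorted_wrt_filter) (simp add: strict_sorted_list_of_set)
    moreover have "(x + 1) div 2 < (y + 1) div 2" if "odd x" "odd y" "x < y" for x y :: nat
      using that by presburger
    ultimately show ?thesis
      unfolding sorted_wrt_map by (rule sorted_wrt_mono_rel[rotated]) auto
  qed
  moreover have "finite (region_sides p D r)"
    using calculation(1) by (metis List.finite_set)
  ultimately have "sorted_list_of_set (region_sides p D r) = ?us"
    by (intro strict_sorted_equal) (simp_all add: strict_sorted_list_of_set)
  moreover have "map (\<lambda>x. p ! ((x + 1) div 2 - 1)) (filter odd xs) = odd_sides p xs" for xs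
    unfolding odd_sides_def
  proof (rule map_cong)
    fix x assume "x \<in> set (filter odd xs)"
    then have "(x + 1) div 2 - 1 = x div 2" by simp
    then show "p ! ((x + 1) div 2 - 1) = p ! (x div 2)" by simp
  qed simp
  ultimately show ?thesis
    unfolding region_polygon_def region_path_def Let_def region_forward_def
    by (cases r; simp add: rev_map[symmetric] comp_def odd_sides_rev)
qed

section \<open>The boundary path of a region\<close>

lemma region_lt_iff:
  assumes D: "D \<in> dissections p" and r: "r \<in> regions D" and \<beta>: "\<beta> \<in> nontrivial_arrows p"
  shows "region_lt r (Some \<beta>) \<longleftrightarrow> r \<noteq> Some \<beta> \<and> region_lo r \<le> lo \<beta> \<and> hi \<beta> \<le> region_hi p r"
  using r \<beta> dissectionD(1)[OF D]
  by (cases r) (auto simp: region_lo_def region_hi_def beyond_iff nontrivial_arrows_iff)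

lemma dissection_nontrivial: "D \<in> dissections p \<Longrightarrow> \<beta> \<in> D \<Longrightarrow> \<beta> \<in> nontrivial_arrows p"
  by (auto simp: dissections_iff)

lemma arrows_beyond_bounds:
  assumes "D \<in> dissections p" "r \<in> regions D" "\<beta> \<in> arrows_beyond D r"
  shows "\<beta> \<in> D" "region_lt r (Some \<beta>)" "region_lo r \<le> lo \<beta>" "hi \<beta> \<le> region_hi p r"
  using assms region_lt_iff[OF assms(1,2), of \<beta>] dissection_nontrivial[OF assms(1), of \<beta>]
  by (auto simp: arrows_beyond_eq)

lemma region_bounds:
  assumes D: "D \<in> dissections p" and r: "r \<in> regions D"
  shows "region_lo r < region_hi p r" "region_hi p r \<le> 2 * weight p + 1"
    "even (region_lo r) \<longleftrightarrow> region_forward r" "odd (region_hi p r) \<longleftrightarrow> region_forward r"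
  using r dissectionD[OF D] lo_less_hi even_hi forward_iff_even_lo
  by (cases r; force simp: region_lo_def region_hi_def region_forward_def)+

lemma region_ends:
  assumes D: "D \<in> dissections p" and r: "r \<in> regions D"
  shows "region_lo r \<in> region_points p D r" "region_hi p r \<in> region_points p D r"
  using arrows_beyond_bounds[OF D r] region_bounds(1)[OF D r]
  by (force simp: region_points_def)+

text \<open>If \<open>x + 1\<close> is skipped, it lies under an outer arrow \<gamma>. As
  \<open>x\<close> and \<open>y\<close> are not strictly under \<gamma>, it starts at
  \<open>x\<close> and reaches at most to \<open>y\<close>; since its other end is a point of the
  region as well, that end is \<open>y\<close>.\<close>

lemma region_points_gap:
  assumes D: "D \<in> dissections p" and r: "r \<in> regions D"
    and x: "x \<in> region_points p D r" and y: "y \<in> region_points p D r" and "x < y"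
    and gap: "\<And>z. x < z \<Longrightarrow> z < y \<Longrightarrow> z \<notin> region_points p D r"
  shows "y = x + 1 \<or> (\<exists>\<beta>\<in>arrows_beyond D r. lo \<beta> = x \<and> hi \<beta> = y)"
proof (cases "y = x + 1")
  case False
  then have "x + 1 < y" using \<open>x < y\<close> by simp
  then have "x + 1 \<notin> region_points p D r" by (intro gap) auto
  then obtain \<beta> where \<beta>: "\<beta> \<in> arrows_beyond D r" "lo \<beta> < x + 1" "x + 1 < hi \<beta>"
    using x y \<open>x + 1 < y\<close> by (auto simp: region_points_def)
  obtain \<gamma> where \<gamma>: "\<gamma> \<in> outer_arrows D r" "lo \<gamma> \<le> lo \<beta>" "hi \<beta> \<le> hi \<gamma>"
    using outer_arrows_exists[OF D \<beta>(1)] .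
  then have \<gamma>': "\<gamma> \<in> arrows_beyond D r" "\<gamma> \<in> D" by (auto simp: outer_arrows_def arrows_beyond_eq)
  have "lo \<gamma> = x"
    using x \<gamma>' \<gamma> \<beta> by (fastforce simp: region_points_def)
  \<comment> \<open>An arrow beyond \<open>r\<close> strictly over this end could not cross
    \<gamma>, so it would enclose and hide it.\<close>
  have "hi \<gamma> \<in> region_points p D r"
  proof -
    have "\<not> (lo \<delta> < hi \<gamma> \<and> hi \<gamma> < hi \<delta>)" if \<delta>: "\<delta> \<in> arrows_beyond D r" for \<delta>
    proof
      assume *: "lo \<delta> < hi \<gamma> \<and> hi \<gamma> < hi \<delta>"
      have "\<delta> \<in> D" using \<delta> by (auto simp: arrows_beyond_eq)
      then have "noncrossing \<gamma> \<delta>" using dissectionD(5)[OF D] \<gamma>' by blast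
      then have "lo \<delta> \<le> lo \<gamma>" using * by (auto simp: noncrossing_def)
      then have "beyond \<delta> \<gamma>"
        using * \<open>\<delta> \<in> D\<close> \<gamma>' dissectionD(1)[OF D] by (subst beyond_iff) auto
      then show False using \<gamma> \<delta> by (auto simp: outer_arrows_def)
    qed
    moreover have "region_lo r \<le> hi \<gamma>" "hi \<gamma> \<le> region_hi p r"
      using arrows_beyond_bounds[OF D r \<gamma>'(1)] lo_less_hi[of \<gamma>] dissectionD(1)[OF D \<gamma>'(2)] by auto
    ultimately show ?thesis by (auto simp: region_points_def)
  qed
  moreover have "hi \<gamma> \<le> y"
    using y \<gamma>' \<open>lo \<gamma> = x\<close> \<open>x < y\<close> by (fastforce simp: region_points_def)
  moreover have "x < hi \<gamma>" using \<gamma> \<beta> by simp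
  ultimately have "hi \<gamma> = y" using gap[of "hi \<gamma>"] by (metis le_neq_implies_less)
  then show ?thesis
    using \<gamma>' \<open>lo \<gamma> = x\<close> by blast
qed simp

lemma region_path_simps [simp]:
  "set (region_path p D r) = region_points p D r"
  "distinct (region_path p D r)"
  by (auto simp: region_path_def Let_def)

lemma region_path_sorted:
  "sorted_wrt (\<lambda>x y. if region_forward r then x < y else y < x) (region_path p D r)"
  by (simp add: region_path_def Let_def sorted_wrt_rev strict_sorted_list_of_set)

lemma region_path_unique:
  assumes "sorted_wrt (\<lambda>x y. if region_forward r then x < y else y < x) xs"
    and "set xs = region_points p D r"
  shows "region_path p D r = xs"
proof (cases "region_forward r")
  case True
  then have "sorted_list_of_set (region_points p D r) = xs"
    using assms by (intro strict_sorted_equal) (simp_all add: strict_sorted_list_of_set)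
  then show ?thesis using True by (simp add: region_path_def)
next
  case False
  then have "sorted_list_of_set (region_points p D r) = rev xs"
    using assms by (intro strict_sorted_equal) (simp_all add: strict_sorted_list_of_set sorted_wrt_rev)
  then show ?thesis using False by (simp add: region_path_def)
qed

lemma sorted_wrt_less_ends:
  fixes xs :: "nat list"
  assumes "sorted_wrt (<) xs" "a \<in> set xs" "b \<in> set xs" "\<And>x. x \<in> set xs \<Longrightarrow> a \<le> x \<and> x \<le> b"
  shows "xs ! 0 = a" "xs ! (length xs - 1) = b"
proof -
  obtain i j where ij: "i < length xs" "xs ! i = a" "j < length xs" "xs ! j = b"
    using assms by (metis in_set_conv_nth)
  have "i = 0"
  proof (rule ccontr)
    assume "i \<noteq> 0"
    then have "xs ! 0 < a" using sorted_wrt_nth_less[OF assms(1), of 0 i] ij by simp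
    moreover have "xs ! 0 \<in> set xs" using ij(1) by (intro nth_mem) linarith
    ultimately show False using assms(4) by (meson not_le)
  qed
  have "j = length xs - 1"
  proof (rule ccontr)
    assume "j \<noteq> length xs - 1"
    then have "b < xs ! (length xs - 1)"
      using sorted_wrt_nth_less[OF assms(1), of j "length xs - 1"] ij by simp
    moreover have "xs ! (length xs - 1) \<in> set xs" using ij(3) by (intro nth_mem) linarith
    ultimately show False using assms(4) by (meson not_le)
  qed
  show "xs ! 0 = a" "xs ! (length xs - 1) = b"
    using ij \<open>i = 0\<close> \<open>j = length xs - 1\<close> by auto
qed

lemma region_path_ends:
  assumes D: "D \<in> dissections p" and r: "r \<in> regions D"
  defines "P \<equiv> region_path p D r"
  shows "region_forward r \<Longrightarrow> P ! 0 = region_lo r \<and> P ! (length P - 1) = region_hi p r"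
    and "\<not> region_forward r \<Longrightarrow> P ! 0 = region_hi p r \<and> P ! (length P - 1) = region_lo r"
    and "2 \<le> length P"
proof -
  let ?W = "region_points p D r"
  let ?ws = "sorted_list_of_set ?W"
  have "\<And>x. x \<in> ?W \<Longrightarrow> region_lo r \<le> x \<and> x \<le> region_hi p r"
    by (simp add: region_points_def)
  then have e: "?ws ! 0 = region_lo r" "?ws ! (length ?ws - 1) = region_hi p r"
    using region_ends[OF D r] sorted_wrt_less_ends[of ?ws "region_lo r" "region_hi p r"]
    by (simp_all add: strict_sorted_list_of_set)
  have "{region_lo r, region_hi p r} \<subseteq> ?W" using region_ends[OF D r] by auto
  then have "2 \<le> card ?W"
    using region_bounds(1)[OF D r] card_mono[of ?W "{region_lo r, region_hi p r}"] by simp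
  then show l: "2 \<le> length P" by (simp add: P_def region_path_def Let_def)
  show "region_forward r \<Longrightarrow> P ! 0 = region_lo r \<and> P ! (length P - 1) = region_hi p r"
    using e by (simp add: P_def region_path_def Let_def)
  show "\<not> region_forward r \<Longrightarrow> P ! 0 = region_hi p r \<and> P ! (length P - 1) = region_lo r"
    using e l by (simp add: P_def region_path_def Let_def rev_nth)
qed

text \<open>Minima and maxima appear because the path of a backward region descends.\<close>

lemma region_path_consecutive:
  assumes D: "D \<in> dissections p" and r: "r \<in> regions D"
    and i: "Suc i < length (region_path p D r)"
  defines "P \<equiv> region_path p D r"
  shows "max (P ! i) (P ! Suc i) = min (P ! i) (P ! Suc i) + 1 \<or>
    (\<exists>\<beta>\<in>arrows_beyond D r. lo \<beta> = min (P ! i) (P ! Suc i) \<and> hi \<beta> = max (P ! i) (P ! Suc i))"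
proof (rule region_points_gap[OF D r])
  have mem: "P ! i \<in> region_points p D r" "P ! Suc i \<in> region_points p D r"
    using i nth_mem[of _ P] by (auto simp: P_def)
  show "min (P ! i) (P ! Suc i) \<in> region_points p D r" "max (P ! i) (P ! Suc i) \<in> region_points p D r"
    using mem by (auto simp: min_def max_def)
  have s: "i' < j \<Longrightarrow> j < length P \<Longrightarrow> if region_forward r then P ! i' < P ! j else P ! j < P ! i'" for i' j
    using region_path_sorted[of r p D] by (simp add: sorted_wrt_iff_nth_less P_def)
  show "min (P ! i) (P ! Suc i) < max (P ! i) (P ! Suc i)"
    using s[of i "Suc i"] i by (auto simp: P_def split: if_splits)
  fix z assume z: "min (P ! i) (P ! Suc i) < z" "z < max (P ! i) (P ! Suc i)"
  show "z \<notin> region_points p D r"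
  proof
    assume "z \<in> region_points p D r"
    then obtain j where j: "j < length P" "P ! j = z"
      by (metis P_def in_set_conv_nth region_path_simps(1))
    have "j < i \<or> j = i \<or> j = Suc i \<or> Suc i < j" by linarith
    then show False
      using j z s[of j i] s[of j "Suc i"] s[of i j] s[of "Suc i" j] i
      by (auto simp: P_def min_def max_def split: if_splits)
  qed
qed

text \<open>Each step of the path is a unit step or a chord of an arrow, and both change the parity.
  The first point is even and the last one odd in either direction.\<close>

lemma region_path_parity:
  assumes D: "D \<in> dissections p" and r: "r \<in> regions D"
  shows "i < length (region_path p D r) \<Longrightarrow> odd (region_path p D r ! i) \<longleftrightarrow> odd i"
    and "even (length (region_path p D r))"
proof -
  let ?P = "region_path p D r"
  have par: "odd (?P ! i) \<longleftrightarrow> odd i" if "i < length ?P" for i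
    using that
  proof (induction i)
    case 0
    then show ?case
      using region_path_ends[OF D r] region_bounds(3,4)[OF D r] by (cases "region_forward r") auto
  next
    case (Suc i)
    let ?a = "min (?P ! i) (?P ! Suc i)" and ?b = "max (?P ! i) (?P ! Suc i)"
    have "odd ?a \<longleftrightarrow> even ?b"
      using region_path_consecutive[OF D r Suc.prems]
    proof
      assume "\<exists>\<beta>\<in>arrows_beyond D r. lo \<beta> = ?a \<and> hi \<beta> = ?b"
      then obtain \<beta> where \<beta>: "\<beta> \<in> arrows_beyond D r" "lo \<beta> = ?a" "hi \<beta> = ?b" by blast
      then show ?thesis
        using even_hi[of \<beta>] dissectionD(1)[OF D] arrows_beyond_bounds(1)[OF D r] by metis
    qed simp
    then show ?case using Suc by (auto simp: min_def max_def split: if_splits)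
  qed
  show "i < length ?P \<Longrightarrow> odd (?P ! i) \<longleftrightarrow> odd i" by (rule par)
  have "odd (length ?P - 1)"
    using par[of "length ?P - 1"] region_path_ends[OF D r] region_bounds(3,4)[OF D r]
    by (cases "region_forward r") auto
  then show "even (length ?P)" using region_path_ends(3)[OF D r] by simp
qed

lemma length_filter_odd:
  assumes "\<And>i. i < length xs \<Longrightarrow> odd (xs ! i) \<longleftrightarrow> odd i"
  shows "length (filter odd xs) = length xs div 2"
  using assms
proof (induction xs rule: rev_induct)
  case (snoc x xs)
  have "length (filter odd xs) = length xs div 2"
  proof (rule snoc.IH)
    fix i assume "i < length xs"
    then show "odd (xs ! i) \<longleftrightarrow> odd i" using snoc.prems[of i] by (simp add: nth_append)
  qed
  moreover have "odd x \<longleftrightarrow> odd (length xs)" using snoc.prems[of "length xs"] by simp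
  ultimately show ?case by auto
qed simp

lemma length_region_polygon:
  assumes D: "D \<in> dissections p" and r: "r \<in> regions D"
  shows "length (region_path p D r) = 2 * length (region_polygon p D r)"
    and "length (region_path p D r) = 2 * weight (region_polygon p D r) + 2"
proof -
  have "length (region_polygon p D r) = length (region_path p D r) div 2"
    using length_filter_odd[of "region_path p D r"] region_path_parity(1)[OF D r]
    by (simp add: region_polygon_eq[OF D r] odd_sides_def)
  then show *: "length (region_path p D r) = 2 * length (region_polygon p D r)"
    using region_path_parity(2)[OF D r] by simp
  then show "length (region_path p D r) = 2 * weight (region_polygon p D r) + 2"
    using region_path_ends(3)[OF D r] by (simp add: weight_def)
qed

section \<open>Adding an arrow to a dissection\<close>

lemma dissections_subset: "E \<in> dissections p \<Longrightarrow> D \<subseteq> E \<Longrightarrow> D \<in> dissections p"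
  by (auto simp: dissections_iff)

text \<open>Arrows of a dissection enclosing \<beta> are nested, so \<open>s\<close> is comparable
  with \<open>r\<close>; it cannot lie strictly after \<open>r\<close>, since \<beta> is not hidden.
  In other words, \<open>r\<close> is the parent of \<open>Some \<beta>\<close> in the dual
  tree.\<close>

lemma region_lt_outer_arrow:
  assumes E: "E \<in> dissections p" and r: "r \<in> regions E" and s: "s \<in> regions E"
    and \<beta>: "\<beta> \<in> outer_arrows E r" and lt: "region_lt s (Some \<beta>)"
  shows "s = r \<or> region_lt s r"
proof (cases s)
  case None
  then show ?thesis by (cases r) auto
next
  case (Some \<delta>)
  have \<delta>: "\<delta> \<in> E" "beyond \<delta> \<beta>" using Some s lt by auto
  have \<beta>': "\<beta> \<in> E" "region_lt r (Some \<beta>)" using \<beta> by (auto simp: outer_arrows_def arrows_beyond_eq)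
  have nb: "\<not> region_lt r (Some \<delta>)" using \<beta> \<delta> by (auto simp: outer_arrows_def arrows_beyond_eq)
  then obtain \<alpha> where \<alpha>: "r = Some \<alpha>" "\<alpha> \<in> E" using r by (cases r) auto
  have sn: "1 \<le> snd \<alpha>" "1 \<le> snd \<delta>" "1 \<le> snd \<beta>"
    using \<alpha> \<delta> \<beta>' dissectionD(1)[OF E] by blast+
  have "lo \<alpha> \<le> lo \<beta>" "hi \<beta> \<le> hi \<alpha>" "lo \<delta> \<le> lo \<beta>" "hi \<beta> \<le> hi \<delta>"
    using \<delta> \<beta>' \<alpha> sn by (auto simp: beyond_iff)
  moreover have "lo \<beta> < hi \<beta>" using lo_less_hi sn by blast
  moreover have "noncrossing \<alpha> \<delta>" using dissectionD(5)[OF E] \<alpha> \<delta> by blast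
  ultimately have "lo \<alpha> \<le> lo \<delta> \<and> hi \<delta> \<le> hi \<alpha> \<or> lo \<delta> \<le> lo \<alpha> \<and> hi \<alpha> \<le> hi \<delta>"
    by (auto simp: noncrossing_def)
  then show ?thesis using nb \<alpha> Some sn by (auto simp: beyond_iff)
qed

text \<open>The chord \<beta> splits the vertex set of \<open>r\<close>, with both of its endpoints
  kept on either side, and leaves all other regions as they were.\<close>

lemma region_points_insert:
  assumes E: "insert \<beta> D \<in> dissections p" and r: "r \<in> regions D" and "\<beta> \<notin> D"
    and \<beta>: "\<beta> \<in> outer_arrows (insert \<beta> D) r"
  shows "region_points p (insert \<beta> D) r = {x \<in> region_points p D r. \<not> (lo \<beta> < x \<and> x < hi \<beta>)}"
    and "region_points p (insert \<beta> D) (Some \<beta>) = {x \<in> region_points p D r. lo \<beta> \<le> x \<and> x \<le> hi \<beta>}"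
    and "s \<in> regions D \<Longrightarrow> s \<noteq> r \<Longrightarrow> region_points p (insert \<beta> D) s = region_points p D s"
proof -
  have D: "D \<in> dissections p" using dissections_subset[OF E] by blast
  have rE: "r \<in> regions (insert \<beta> D)" using r by (auto simp: regions_def)
  have lt: "region_lt r (Some \<beta>)" using \<beta> by (auto simp: outer_arrows_def arrows_beyond_eq)
  have \<beta>n: "\<beta> \<in> nontrivial_arrows p" using dissection_nontrivial[OF E] by blast
  have bnd: "region_lo r \<le> lo \<beta>" "hi \<beta> \<le> region_hi p r"
    using region_lt_iff[OF D r \<beta>n] lt by auto
  have "arrows_beyond (insert \<beta> D) r = insert \<beta> (arrows_beyond D r)"
    using lt by (auto simp: arrows_beyond_eq)
  then show "region_points p (insert \<beta> D) r = {x \<in> region_points p D r. \<not> (lo \<beta> < x \<and> x < hi \<beta>)}"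
    by (auto simp: region_points_def)
  have ab: "arrows_beyond (insert \<beta> D) (Some \<beta>) = {\<delta> \<in> D. beyond \<beta> \<delta>}"
    using region_lt_irrefl[of "Some \<beta>"] by (auto simp: arrows_beyond_eq)
  show "region_points p (insert \<beta> D) (Some \<beta>) = {x \<in> region_points p D r. lo \<beta> \<le> x \<and> x \<le> hi \<beta>}"
  proof (intro equalityI subsetI)
    fix x assume x: "x \<in> region_points p (insert \<beta> D) (Some \<beta>)"
    have xb: "lo \<beta> \<le> x" "x \<le> hi \<beta>" using x by (auto simp: region_points_def region_lo_def region_hi_def)
    have "\<not> (lo \<delta> < x \<and> x < hi \<delta>)" if \<delta>: "\<delta> \<in> arrows_beyond D r" for \<delta>
    proof (cases "beyond \<beta> \<delta>")
      case True
      then show ?thesis using x \<delta> unfolding region_points_def ab by (auto simp: arrows_beyond_eq)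
    next
      \<comment> \<open>Here \<delta> is not enclosed by \<beta>, and it does not enclose \<beta>
        because \<beta> is outer. Not crossing, the two chords have disjoint interiors.\<close>
      case False
      have \<delta>': "\<delta> \<in> D" using \<delta> by (auto simp: arrows_beyond_eq)
      have "\<not> beyond \<delta> \<beta>" using \<beta> \<delta> by (auto simp: outer_arrows_def arrows_beyond_eq)
      moreover have "1 \<le> snd \<delta>" "1 \<le> snd \<beta>" using \<delta>' dissectionD(1)[OF E] by blast+
      moreover have "\<delta> \<noteq> \<beta>" using \<delta>' \<open>\<beta> \<notin> D\<close> by blast
      moreover have "noncrossing \<beta> \<delta>" using dissectionD(5)[OF E] \<delta>' by blast
      ultimately show ?thesis using xb False by (auto simp: beyond_iff noncrossing_def)
    qed
    then show "x \<in> {x \<in> region_points p D r. lo \<beta> \<le> x \<and> x \<le> hi \<beta>}"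
      using xb bnd by (auto simp: region_points_def)
  next
    fix x assume x: "x \<in> {x \<in> region_points p D r. lo \<beta> \<le> x \<and> x \<le> hi \<beta>}"
    have "\<delta> \<in> arrows_beyond D r" if \<delta>: "\<delta> \<in> D" "beyond \<beta> \<delta>" for \<delta>
      using region_lt_trans[OF E rE, of "Some \<beta>" "Some \<delta>"] \<delta> lt by (auto simp: arrows_beyond_eq)
    then show "x \<in> region_points p (insert \<beta> D) (Some \<beta>)"
      using x by (auto simp: region_points_def ab region_lo_def region_hi_def)
  qed
  show "region_points p (insert \<beta> D) s = region_points p D s" if s: "s \<in> regions D" "s \<noteq> r"
  proof (cases "region_lt s (Some \<beta>)")
    case False
    then have "arrows_beyond (insert \<beta> D) s = arrows_beyond D s" by (auto simp: arrows_beyond_eq)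
    then show ?thesis by (simp add: region_points_def)
  next
    \<comment> \<open>Such an \<open>s\<close> lies strictly before
      \<open>r = Some \<alpha>\<close>, and \<alpha> already hides every point strictly under
      \<beta>.\<close>
    case True
    then have ab': "arrows_beyond (insert \<beta> D) s = insert \<beta> (arrows_beyond D s)" by (auto simp: arrows_beyond_eq)
    have "s \<in> regions (insert \<beta> D)" using s by (auto simp: regions_def)
    then have "region_lt s r" using region_lt_outer_arrow[OF E rE _ \<beta> True] s by blast
    then obtain \<alpha> where \<alpha>: "r = Some \<alpha>" "\<alpha> \<in> arrows_beyond D s"
      using r by (cases r) (auto simp: arrows_beyond_eq)
    have "lo \<alpha> \<le> lo \<beta>" "hi \<beta> \<le> hi \<alpha>" using bnd \<alpha> by (auto simp: region_lo_def region_hi_def)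
    then show ?thesis using \<alpha> unfolding region_points_def ab' by force
  qed
qed

text \<open>An arrow of \<open>D\<close> beyond \<open>r\<close> and strictly over an endpoint of
  \<beta> would cross \<beta> or hide it.\<close>

lemma outer_arrow_endpoints:
  assumes E: "insert \<beta> D \<in> dissections p" and r: "r \<in> regions D" and "\<beta> \<notin> D"
    and \<beta>: "\<beta> \<in> outer_arrows (insert \<beta> D) r"
  shows "lo \<beta> \<in> region_points p D r" "hi \<beta> \<in> region_points p D r"
proof -
  have D: "D \<in> dissections p" using dissections_subset[OF E] by blast
  have lt: "region_lt r (Some \<beta>)" using \<beta> by (auto simp: outer_arrows_def arrows_beyond_eq)
  have bnd: "region_lo r \<le> lo \<beta>" "hi \<beta> \<le> region_hi p r"
    using region_lt_iff[OF D r dissection_nontrivial[OF E insertI1]] lt by auto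
  have s: "1 \<le> snd \<beta>" using dissectionD(1)[OF E] by blast
  have "\<not> (lo \<delta> < x \<and> x < hi \<delta>)" if \<delta>: "\<delta> \<in> arrows_beyond D r" and x: "x = lo \<beta> \<or> x = hi \<beta>" for \<delta> x
  proof -
    have \<delta>': "\<delta> \<in> D" using \<delta> by (auto simp: arrows_beyond_eq)
    have "\<not> beyond \<delta> \<beta>" using \<beta> \<delta> by (auto simp: outer_arrows_def arrows_beyond_eq)
    moreover have "1 \<le> snd \<delta>" using \<delta>' dissectionD(1)[OF E] by blast
    moreover have "\<delta> \<noteq> \<beta>" using \<delta>' \<open>\<beta> \<notin> D\<close> by blast
    moreover have "noncrossing \<beta> \<delta>" using dissectionD(5)[OF E] \<delta>' by blast
    ultimately show ?thesis using x s lo_less_hi[OF s] by (auto simp: beyond_iff noncrossing_def)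
  qed
  then show "lo \<beta> \<in> region_points p D r" "hi \<beta> \<in> region_points p D r"
    using bnd lo_less_hi[OF s] by (auto simp: region_points_def)
qed

section \<open>The arrows that split a given region\<close>

definition addable_arrows :: "'r list \<Rightarrow> arrow set \<Rightarrow> region \<Rightarrow> arrow set" where
  "addable_arrows p D r =
     {\<beta>. \<beta> \<notin> D \<and> insert \<beta> D \<in> dissections p \<and> \<beta> \<in> outer_arrows (insert \<beta> D) r}"

text \<open>The point \<open>z\<close> ensures that \<beta> is not a boundary edge of the region;
  \<open>proper\<close> excludes the remaining edge, the one closing the path.\<close>

lemma addable_arrowsI:
  assumes D: "D \<in> dissections p" and r: "r \<in> regions D" and \<beta>s: "1 \<le> snd \<beta>"
    and W: "lo \<beta> \<in> region_points p D r" "hi \<beta> \<in> region_points p D r"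
    and z: "z \<in> region_points p D r" "lo \<beta> < z" "z < hi \<beta>"
    and proper: "\<not> (lo \<beta> = region_lo r \<and> hi \<beta> = region_hi p r)"
  shows "\<beta> \<in> addable_arrows p D r"
proof -
  have bnd: "region_lo r \<le> lo \<beta>" "hi \<beta> \<le> region_hi p r"
    using W by (auto simp: region_points_def)
  have \<beta>n: "\<beta> \<in> nontrivial_arrows p"
  proof -
    \<comment> \<open>The point \<open>z\<close> rules out distance 1 and parity rules out distance
      2, which leaves at least 3.\<close>
    have "hi \<beta> \<noteq> lo \<beta> + 2" using even_hi[OF \<beta>s] by auto
    moreover have "\<not> (lo \<beta> = 0 \<and> hi \<beta> = 2 * weight p + 1)"
      using proper bnd region_bounds(2)[OF D r] by auto
    ultimately show ?thesis
      using \<beta>s z bnd region_bounds(2)[OF D r] by (auto simp: nontrivial_arrows_iff)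
  qed
  have lt: "region_lt r (Some \<beta>)"
    using region_lt_iff[OF D r \<beta>n] bnd proper by (auto simp: region_lo_def region_hi_def)
  \<comment> \<open>An arrow enclosing \<beta> would have \<open>z\<close> strictly under it, but
    \<open>z\<close> is a point of the region.\<close>
  have no: "\<not> (lo \<delta> \<le> lo \<beta> \<and> hi \<beta> \<le> hi \<delta>)" if "\<delta> \<in> arrows_beyond D r" for \<delta>
    using that z unfolding region_points_def by force
  have "\<beta> \<notin> D" using no[of \<beta>] lt by (auto simp: arrows_beyond_eq)
  have nc: "noncrossing \<beta> \<delta> \<and> noncrossing \<delta> \<beta>" if \<delta>: "\<delta> \<in> D" for \<delta>
  proof (cases "region_lt r (Some \<delta>)")
    case True
    then have "\<delta> \<in> arrows_beyond D r" using \<delta> by (auto simp: arrows_beyond_eq)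
    then show ?thesis using W by (auto simp: region_points_def noncrossing_def)
  next
    \<comment> \<open>The arrow \<delta> does not cross \<alpha> and is not properly enclosed by it.
      As \<beta> lies inside \<alpha>, it cannot meet \<delta> either.\<close>
    case False
    then obtain \<alpha> where \<alpha>: "r = Some \<alpha>" "\<alpha> \<in> D" using r by (cases r) auto
    have "lo \<alpha> \<le> lo \<beta>" "hi \<beta> \<le> hi \<alpha>" using bnd \<alpha> by (auto simp: region_lo_def region_hi_def)
    moreover have "noncrossing \<alpha> \<delta>" using \<alpha> \<delta> dissectionD(5)[OF D] by blast
    moreover have "\<alpha> = \<delta> \<or> \<not> (lo \<alpha> \<le> lo \<delta> \<and> hi \<delta> \<le> hi \<alpha>)"
      using False \<alpha> \<delta> dissectionD(1)[OF D] by (auto simp: beyond_iff)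
    ultimately show ?thesis by (auto simp: noncrossing_def)
  qed
  have "insert \<beta> D \<in> dissections p"
    using D \<beta>n nc unfolding dissections_iff by (auto simp: noncrossing_def)
  moreover have "\<beta> \<in> outer_arrows (insert \<beta> D) r"
  proof -
    have "\<not> beyond \<delta> \<beta>" if \<delta>: "\<delta> \<in> arrows_beyond (insert \<beta> D) r" for \<delta>
    proof (cases "\<delta> = \<beta>")
      case False
      then have \<delta>': "\<delta> \<in> arrows_beyond D r" using \<delta> by (auto simp: arrows_beyond_eq)
      then have "1 \<le> snd \<delta>" using dissectionD(1)[OF D] by (auto simp: arrows_beyond_eq)
      then show ?thesis using no[OF \<delta>'] \<beta>s by (auto simp: beyond_iff)
    qed (simp add: beyond_def)
    then show ?thesis using lt by (auto simp: outer_arrows_def arrows_beyond_eq)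
  qed
  ultimately show ?thesis using \<open>\<beta> \<notin> D\<close> by (simp add: addable_arrows_def)
qed

text \<open>An arrow of the region's polygon uses positions in the path as coordinates. Looking
  these up gives marked points of the original polygon, which are decoded into a vertex number (even
  point) and a side number (odd point).\<close>

definition path_arrow :: "nat list \<Rightarrow> arrow \<Rightarrow> arrow" where
  "path_arrow P \<gamma> = (P ! (2 * fst \<gamma>) div 2, (P ! (2 * snd \<gamma> - 1) + 1) div 2)"

text \<open>On a backward region the path descends: \<open>lo\<close> and \<open>hi\<close> are
  exchanged and the arrow changes its direction.\<close>

lemma path_arrow_props:
  assumes D: "D \<in> dissections p" and r: "r \<in> regions D"
    and \<gamma>: "\<gamma> \<in> nontrivial_arrows (region_polygon p D r)"
  defines "P \<equiv> region_path p D r"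
  shows "hi \<gamma> < length P" "\<not> (lo \<gamma> = 0 \<and> hi \<gamma> = length P - 1)" "1 \<le> snd (path_arrow P \<gamma>)"
    "2 * fst (path_arrow P \<gamma>) = P ! (2 * fst \<gamma>)" "2 * snd (path_arrow P \<gamma>) - 1 = P ! (2 * snd \<gamma> - 1)"
    "region_forward r \<Longrightarrow> lo (path_arrow P \<gamma>) = P ! lo \<gamma> \<and> hi (path_arrow P \<gamma>) = P ! hi \<gamma>"
    "\<not> region_forward r \<Longrightarrow> lo (path_arrow P \<gamma>) = P ! hi \<gamma> \<and> hi (path_arrow P \<gamma>) = P ! lo \<gamma>"
    "forward (path_arrow P \<gamma>) \<longleftrightarrow> (forward \<gamma> \<longleftrightarrow> region_forward r)"
proof -
  have g: "1 \<le> snd \<gamma>" "lo \<gamma> + 3 \<le> hi \<gamma>" "hi \<gamma> \<le> 2 * weight (region_polygon p D r) + 1"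
    "\<not> (lo \<gamma> = 0 \<and> hi \<gamma> = 2 * weight (region_polygon p D r) + 1)"
    using \<gamma> by (auto simp: nontrivial_arrows_iff)
  have len: "length P = 2 * weight (region_polygon p D r) + 2"
    using length_region_polygon(2)[OF D r] by (simp add: P_def)
  show h: "hi \<gamma> < length P" "\<not> (lo \<gamma> = 0 \<and> hi \<gamma> = length P - 1)" using g len by auto
  have par: "odd (P ! i) \<longleftrightarrow> odd i" if "i < length P" for i
    using that region_path_parity(1)[OF D r] by (simp add: P_def)
  have ev: "even (P ! (2 * fst \<gamma>))" using par[of "2 * fst \<gamma>"] h by (simp add: hi_def)
  have od: "odd (P ! (2 * snd \<gamma> - 1))" using par[of "2 * snd \<gamma> - 1"] h g by (simp add: hi_def)
  obtain m where m: "P ! (2 * snd \<gamma> - 1) = 2 * m + 1" using od by (rule oddE)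
  show e: "1 \<le> snd (path_arrow P \<gamma>)" "2 * fst (path_arrow P \<gamma>) = P ! (2 * fst \<gamma>)"
    "2 * snd (path_arrow P \<gamma>) - 1 = P ! (2 * snd \<gamma> - 1)"
    using ev m by (simp_all add: path_arrow_def)
  have "if region_forward r then P ! lo \<gamma> < P ! hi \<gamma> else P ! hi \<gamma> < P ! lo \<gamma>"
    using region_path_sorted[of r p D] h g by (simp add: P_def sorted_wrt_iff_nth_less)
  then show l: "region_forward r \<Longrightarrow> lo (path_arrow P \<gamma>) = P ! lo \<gamma> \<and> hi (path_arrow P \<gamma>) = P ! hi \<gamma>"
    "\<not> region_forward r \<Longrightarrow> lo (path_arrow P \<gamma>) = P ! hi \<gamma> \<and> hi (path_arrow P \<gamma>) = P ! lo \<gamma>"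
    unfolding lo_def[of "path_arrow P \<gamma>"] hi_def[of "path_arrow P \<gamma>"] e(2,3)
    using g by (cases rule: lo_hi_cases[OF g(1)]; simp)+
  show "forward (path_arrow P \<gamma>) \<longleftrightarrow> (forward \<gamma> \<longleftrightarrow> region_forward r)"
    using l forward_iff_even_lo[OF g(1)] forward_iff_even_lo[OF e(1)] par[of "lo \<gamma>"] par[of "hi \<gamma>"]
      even_hi[OF g(1)] h g(2)
    by (cases "region_forward r") auto
qed

text \<open>Both sides describe the chords between path points of opposite parity that are not edges
  of the region: non-adjacent positions inside the path, and not its two ends.\<close>

lemma bij_betw_path_arrow:
  assumes D: "D \<in> dissections p" and r: "r \<in> regions D"
  shows "bij_betw (path_arrow (region_path p D r)) (nontrivial_arrows (region_polygon p D r))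
    (addable_arrows p D r)"
proof -
  define P where "P = region_path p D r"
  define q where "q = region_polygon p D r"
  have len: "length P = 2 * weight q + 2"
    using length_region_polygon(2)[OF D r] by (simp add: P_def q_def)
  have nth_P: "P ! i \<in> region_points p D r" if "i < length P" for i
    using that nth_mem[of i P] by (simp add: P_def)
  have srt: "if region_forward r then P ! i < P ! j else P ! j < P ! i" if "i < j" "j < length P" for i j
    using that region_path_sorted[of r p D] by (simp add: P_def sorted_wrt_iff_nth_less)
  have inj: "P ! i = P ! j \<longleftrightarrow> i = j" if "i < length P" "j < length P" for i j
    using that nth_eq_iff_index_eq[of P i j] by (simp add: P_def)
  have g: "1 \<le> snd \<gamma>" "lo \<gamma> + 3 \<le> hi \<gamma>" "hi \<gamma> < length P" "2 * fst \<gamma> < length P" "2 * snd \<gamma> - 1 < length P"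
    if "\<gamma> \<in> nontrivial_arrows q" for \<gamma>
    using that len by (auto simp: nontrivial_arrows_iff hi_def)
  show ?thesis
    unfolding P_def[symmetric] q_def[symmetric]
  proof (rule bij_betw_imageI)
    show "inj_on (path_arrow P) (nontrivial_arrows q)"
    proof (rule inj_onI)
      fix \<gamma> \<delta> assume a: "\<gamma> \<in> nontrivial_arrows q" "\<delta> \<in> nontrivial_arrows q" "path_arrow P \<gamma> = path_arrow P \<delta>"
      have "P ! (2 * fst \<gamma>) = P ! (2 * fst \<delta>)" "P ! (2 * snd \<gamma> - 1) = P ! (2 * snd \<delta> - 1)"
        using path_arrow_props(4,5)[OF D r, folded P_def q_def] a by metis+
      then have "2 * fst \<gamma> = 2 * fst \<delta>" "2 * snd \<gamma> - 1 = 2 * snd \<delta> - 1"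
        using inj g[OF a(1)] g[OF a(2)] by blast+
      then show "\<gamma> = \<delta>" using g(1)[OF a(1)] g(1)[OF a(2)] by (intro prod_eqI) auto
    qed
    show "path_arrow P ` nontrivial_arrows q = addable_arrows p D r"
    proof (intro equalityI subsetI)
      fix \<beta> assume "\<beta> \<in> path_arrow P ` nontrivial_arrows q"
      then obtain \<gamma> where \<gamma>: "\<gamma> \<in> nontrivial_arrows q" "\<beta> = path_arrow P \<gamma>" by blast
      note pp = path_arrow_props[OF D r, folded P_def q_def, OF \<gamma>(1), folded \<gamma>(2)]
      have i: "lo \<gamma> < lo \<gamma> + 1" "lo \<gamma> + 1 < hi \<gamma>" "hi \<gamma> < length P" using g[OF \<gamma>(1)] by auto
      have ends: "(lo \<beta> = P ! lo \<gamma> \<and> hi \<beta> = P ! hi \<gamma> \<and> region_forward r) \<or>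
        (lo \<beta> = P ! hi \<gamma> \<and> hi \<beta> = P ! lo \<gamma> \<and> \<not> region_forward r)"
        using pp(6,7) by blast
      have *: "P ! lo \<gamma> \<in> region_points p D r" "P ! hi \<gamma> \<in> region_points p D r" "P ! (lo \<gamma> + 1) \<in> region_points p D r"
        using nth_P i by auto
      show "\<beta> \<in> addable_arrows p D r"
      proof (rule addable_arrowsI[OF D r pp(3)])
        show "lo \<beta> \<in> region_points p D r" "hi \<beta> \<in> region_points p D r" using ends * by auto
        \<comment> \<open>The position after \<open>lo \<gamma>\<close> is still before
          \<open>hi \<gamma>\<close>, as these differ by at least 3.\<close>
        show "P ! (lo \<gamma> + 1) \<in> region_points p D r" by (rule *)
        show "lo \<beta> < P ! (lo \<gamma> + 1)" "P ! (lo \<gamma> + 1) < hi \<beta>"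
          using ends srt[of "lo \<gamma>" "lo \<gamma> + 1"] srt[of "lo \<gamma> + 1" "hi \<gamma>"] i by (auto split: if_splits)
        show "\<not> (lo \<beta> = region_lo r \<and> hi \<beta> = region_hi p r)"
        proof
          assume "lo \<beta> = region_lo r \<and> hi \<beta> = region_hi p r"
          then have "P ! lo \<gamma> = P ! 0" "P ! hi \<gamma> = P ! (length P - 1)"
            using ends region_path_ends(1,2)[OF D r, folded P_def] by auto
          moreover have "0 < length P" using i by linarith
          ultimately have "lo \<gamma> = 0" "hi \<gamma> = length P - 1"
            using inj[of "lo \<gamma>" 0] inj[of "hi \<gamma>" "length P - 1"] i by auto
          then show False using pp(2) by blast
        qed
      qed
    next
      fix \<beta> assume "\<beta> \<in> addable_arrows p D r"
      then have \<beta>: "\<beta> \<notin> D" "insert \<beta> D \<in> dissections p" "\<beta> \<in> outer_arrows (insert \<beta> D) r"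
        by (auto simp: addable_arrows_def)
      have b: "1 \<le> snd \<beta>" "lo \<beta> + 3 \<le> hi \<beta>" using dissectionD(1,2)[OF \<beta>(2) insertI1] by auto
      have \<beta>n: "\<beta> \<in> nontrivial_arrows p" using dissection_nontrivial[OF \<beta>(2)] by blast
      have W: "lo \<beta> \<in> region_points p D r" "hi \<beta> \<in> region_points p D r"
        using outer_arrow_endpoints[OF \<beta>(2) r \<beta>(1,3)] by auto
      then have "2 * fst \<beta> \<in> set P" "2 * snd \<beta> - 1 \<in> set P"
        by (auto simp: P_def lo_def hi_def min_def max_def split: if_splits)
      then obtain i j where ij: "i < length P" "P ! i = 2 * fst \<beta>" "j < length P" "P ! j = 2 * snd \<beta> - 1"
        by (metis in_set_conv_nth)
      have par: "even i" "odd j"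
        using region_path_parity(1)[OF D r, folded P_def, of i] region_path_parity(1)[OF D r, folded P_def, of j] ij b
        by auto
      then obtain k l where kl: "i = 2 * k" "j = 2 * l + 1" by (meson evenE oddE)
      define \<gamma> where "\<gamma> = (k, l + 1)"
      have lh: "lo \<gamma> = min i j" "hi \<gamma> = max i j" by (simp_all add: \<gamma>_def lo_def hi_def kl)
      have pa: "path_arrow P \<gamma> = \<beta>"
        using ij b by (intro prod_eqI) (auto simp: path_arrow_def \<gamma>_def kl)
      have lohi: "lo \<beta> = min (P ! i) (P ! j)" "hi \<beta> = max (P ! i) (P ! j)"
        by (simp_all add: lo_def hi_def ij)
      \<comment> \<open>Adjacent positions are joined by a unit step, too short for \<beta>, or by
        the chord of an arrow of \<open>D\<close>, which would then be \<beta> itself.\<close>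
      have cons: "\<not> (i' + 1 = j' \<and> j' < length P \<and> min (P ! i') (P ! j') = lo \<beta> \<and> max (P ! i') (P ! j') = hi \<beta>)" for i' j'
      proof
        assume a: "i' + 1 = j' \<and> j' < length P \<and> min (P ! i') (P ! j') = lo \<beta> \<and> max (P ! i') (P ! j') = hi \<beta>"
        then have "hi \<beta> = lo \<beta> + 1 \<or> (\<exists>\<delta>\<in>arrows_beyond D r. lo \<delta> = lo \<beta> \<and> hi \<delta> = hi \<beta>)"
          using region_path_consecutive[OF D r, folded P_def, of i'] by auto
        then obtain \<delta> where \<delta>: "\<delta> \<in> D" "lo \<delta> = lo \<beta>" "hi \<delta> = hi \<beta>"
          using b by (auto simp: arrows_beyond_eq)
        then have "\<delta> = \<beta>" using lo_hi_inj b dissectionD(1)[OF D] by blast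
        then show False using \<delta> \<beta> by blast
      qed
      have "i \<noteq> j" using par by auto
      have "hi \<gamma> \<noteq> lo \<gamma> + 1"
        using cons[of i j] cons[of j i] lohi ij unfolding lh by (auto simp: min_def max_def split: if_splits)
      moreover have "hi \<gamma> \<noteq> lo \<gamma> + 2" using par unfolding lh by (auto simp: min_def max_def)
      moreover have "lo \<gamma> < hi \<gamma>" using \<open>i \<noteq> j\<close> unfolding lh by auto
      moreover have "hi \<gamma> < length P" using ij unfolding lh by auto
      \<comment> \<open>A chord joining both ends of the path is trivial for the root region, and
        for \<open>Some \<alpha>\<close> it is \<alpha>, which belongs to \<open>D\<close>.\<close>
      moreover have "\<not> (lo \<gamma> = 0 \<and> hi \<gamma> = length P - 1)"
      proof
        assume a: "lo \<gamma> = 0 \<and> hi \<gamma> = length P - 1"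
        then have "i = 0 \<and> j = length P - 1 \<or> j = 0 \<and> i = length P - 1"
          unfolding lh by (auto simp: min_def max_def split: if_splits)
        then have "lo \<beta> = min (P ! 0) (P ! (length P - 1)) \<and> hi \<beta> = max (P ! 0) (P ! (length P - 1))"
          unfolding lohi by (auto simp: min.commute max.commute)
        then have e: "lo \<beta> = region_lo r" "hi \<beta> = region_hi p r"
          using region_path_ends(1,2)[OF D r, folded P_def] region_bounds(1)[OF D r]
          by (cases "region_forward r"; simp)+
        show False
        proof (cases r)
          case None
          then show ?thesis using e \<beta>n by (auto simp: region_lo_def region_hi_def nontrivial_arrows_iff)
        next
          case (Some \<alpha>)
          then have "\<alpha> = \<beta>" using e r b dissectionD(1)[OF D]
            by (intro lo_hi_inj) (auto simp: region_lo_def region_hi_def)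
          then show ?thesis using \<beta>(1) r Some by simp
        qed
      qed
      ultimately have "\<gamma> \<in> nontrivial_arrows q"
        using len by (auto simp: nontrivial_arrows_iff \<gamma>_def)
      then show "\<beta> \<in> path_arrow P ` nontrivial_arrows q" using pa by blast
    qed
  qed
qed

section \<open>The two polygons into which an arrow cuts a region\<close>

lemma odd_sides_simps [simp]:
  "odd_sides p [] = []" "odd_sides p (xs @ ys) = odd_sides p xs @ odd_sides p ys"
  "odd_sides p (x # xs) = (if odd x then p ! (x div 2) # odd_sides p xs else odd_sides p xs)"
  by (simp_all add: odd_sides_def)

text \<open>Stated for a prefix, so that the parity of a whole path can be used directly.\<close>

lemma length_odd_sides:
  assumes "\<And>i. i < length (xs @ ys) \<Longrightarrow> odd ((xs @ ys) ! i) \<longleftrightarrow> odd i"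
  shows "length (odd_sides p xs) = length xs div 2"
  unfolding odd_sides_def length_map
proof (rule length_filter_odd)
  fix i assume "i < length xs"
  then show "odd (xs ! i) \<longleftrightarrow> odd i" using assms[of i] by (simp add: nth_append)
qed

text \<open>Exactly one of \<open>a\<close>, \<open>b\<close> is odd, namely the side where \<gamma>
  ends. It occurs in both resulting paths, just as it occurs in both \<open>root_part\<close> and
  \<open>cut_part\<close>.\<close>

lemma odd_sides_cut:
  assumes par: "\<And>i. i < length P \<Longrightarrow> odd (P ! i) \<longleftrightarrow> odd i"
    and P: "P = A @ a # M @ b # C" and "1 \<le> snd \<gamma>" "length A = lo \<gamma>" "length A + length M + 1 = hi \<gamma>"
  shows "root_part (odd_sides p P) \<gamma> = odd_sides p (A @ a # b # C)" (is ?root)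
    and "cut_part (odd_sides p P) \<gamma> = odd_sides p (if forward \<gamma> then a # M @ [b] else rev (a # M @ [b]))" (is ?cut)
proof -
  have a: "odd a \<longleftrightarrow> odd (length A)"
    using par[of "length A"] by (simp add: P)
  have b: "odd b \<longleftrightarrow> odd (length A + length M + 1)"
    using par[of "length A + length M + 1"] by (simp add: P nth_append)
  have lA: "length (odd_sides p A) = length A div 2"
    using par unfolding P by (rule length_odd_sides)
  have "length (odd_sides p (A @ a # M)) = length (A @ a # M) div 2"
    using par unfolding P by (intro length_odd_sides[of _ "b # C"]) simp
  \<comment> \<open>Lengths are computed to locate the cuts made by \<open>take\<close> and
    \<open>drop\<close>; whether \<open>a\<close> is itself a side shifts them by one.\<close>
  then have lM: "length A div 2 + (if odd a then 1 else 0) + length (odd_sides p M) = (length A + length M + 1) div 2"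
    by (auto simp: lA)
  show ?root ?cut
  proof -
    have "?root \<and> ?cut"
      using assms(3)
    proof (cases rule: lo_hi_cases)
      case (fwd k l)
      then have l: "length A = 2 * k" "length A + length M + 1 = 2 * l + 1" using assms(4,5) by simp_all
      then have e: "even a" "odd b" using a b by simp_all
      have "length (odd_sides p A) = k" "length (odd_sides p M) = l - k"
        using lA lM l e by simp_all
      then show ?thesis
        using fwd e by (simp add: P root_part_def cut_part_def forward_def)
    next
      case (bwd k l)
      then have l: "length A = 2 * l + 1" "length A + length M + 1 = 2 * k" using assms(4,5) by simp_all
      then have e: "odd a" "even b" using a b by simp_all
      have "length (odd_sides p A) = l" "length (odd_sides p M) = k - l - 1"
        using lA lM l e by simp_all
      moreover have "k - l = Suc (k - Suc l)" using bwd by simp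
      ultimately show ?thesis
        using bwd e by (simp add: P root_part_def cut_part_def forward_def odd_sides_rev)
    qed
    then show ?root ?cut by simp_all
  qed
qed

text \<open>The segment from \<open>a\<close> to \<open>b\<close> runs in the direction of
  \<open>r\<close>. The far region has that same direction iff \<gamma> is forward, so its path is
  reversed exactly for backward \<gamma>, whatever the direction of \<open>r\<close>.\<close>

lemma region_path_cut:
  assumes D: "D \<in> dissections p" and r: "r \<in> regions D"
    and \<gamma>: "\<gamma> \<in> nontrivial_arrows (region_polygon p D r)"
  defines "\<beta> \<equiv> path_arrow (region_path p D r) \<gamma>"
  obtains A a M b C where "region_path p D r = A @ a # M @ b # C"
    "length A = lo \<gamma>" "length A + length M + 1 = hi \<gamma>"
    "region_path p (insert \<beta> D) r = A @ a # b # C"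
    "region_path p (insert \<beta> D) (Some \<beta>) = (if forward \<gamma> then a # M @ [b] else rev (a # M @ [b]))"
proof -
  define P where "P = region_path p D r"
  note pp = path_arrow_props[OF D r \<gamma>, folded P_def, folded \<beta>_def[folded P_def]]
  have "\<beta> \<in> addable_arrows p D r"
    using bij_betw_path_arrow[OF D r] \<gamma> unfolding \<beta>_def by (rule bij_betwE[rule_format])
  then have \<beta>: "\<beta> \<notin> D" "insert \<beta> D \<in> dissections p" "\<beta> \<in> outer_arrows (insert \<beta> D) r"
    by (auto simp: addable_arrows_def)
  have ij: "lo \<gamma> < hi \<gamma>" "hi \<gamma> < length P"
    using \<gamma> pp(1) by (auto simp: nontrivial_arrows_iff)
  define A a M b C where "A = take (lo \<gamma>) P" and "a = P ! lo \<gamma>"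
    and "M = take (hi \<gamma> - lo \<gamma> - 1) (drop (lo \<gamma> + 1) P)" and "b = P ! hi \<gamma>" and "C = drop (hi \<gamma> + 1) P"
  have len: "length A = lo \<gamma>" "length A + length M + 1 = hi \<gamma>"
    using ij by (auto simp: A_def M_def)
  have "drop (lo \<gamma> + 1) P = M @ drop (hi \<gamma>) P"
    using ij append_take_drop_id[of "hi \<gamma> - lo \<gamma> - 1" "drop (lo \<gamma> + 1) P"] by (simp add: M_def)
  then have P: "P = A @ a # M @ b # C"
    using ij id_take_nth_drop[of "lo \<gamma>" P] Cons_nth_drop_Suc[of "hi \<gamma>" P]
    by (simp add: A_def a_def b_def C_def)
  have srt: "sorted_wrt (\<lambda>x y. if region_forward r then x < y else y < x) P"
    unfolding P_def by (rule region_path_sorted)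
  have set_P: "set P = region_points p D r" by (simp add: P_def)
  have ends: "region_forward r \<Longrightarrow> lo \<beta> = a \<and> hi \<beta> = b" "\<not> region_forward r \<Longrightarrow> lo \<beta> = b \<and> hi \<beta> = a"
    using pp(6,7) by (auto simp: a_def b_def)
  have ord: "x \<in> set M \<Longrightarrow> lo \<beta> < x \<and> x < hi \<beta>" "x \<in> set A \<union> set C \<Longrightarrow> x < lo \<beta> \<or> hi \<beta> < x"
    "a \<in> {lo \<beta>, hi \<beta>}" "b \<in> {lo \<beta>, hi \<beta>}" "lo \<beta> < hi \<beta>" for x
    using srt ends unfolding P
    by (cases "region_forward r"; simp add: sorted_wrt_append; blast)+
  note pts = region_points_insert[OF \<beta>(2) r \<beta>(1,3)]
  have 1: "region_path p (insert \<beta> D) r = A @ a # b # C"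
  proof (rule region_path_unique)
    show "sorted_wrt (\<lambda>x y. if region_forward r then x < y else y < x) (A @ a # b # C)"
      using srt unfolding P by (auto simp: sorted_wrt_append)
    show "set (A @ a # b # C) = region_points p (insert \<beta> D) r"
      unfolding pts(1) set_P[symmetric] P using ord by fastforce
  qed
  have 2: "region_path p (insert \<beta> D) (Some \<beta>) = (if forward \<gamma> then a # M @ [b] else rev (a # M @ [b]))"
  proof (rule region_path_unique)
    have "region_forward (Some \<beta>) \<longleftrightarrow> (forward \<gamma> \<longleftrightarrow> region_forward r)"
      using pp(8) by (simp add: region_forward_def)
    then show "sorted_wrt (\<lambda>x y. if region_forward (Some \<beta>) then x < y else y < x)
        (if forward \<gamma> then a # M @ [b] else rev (a # M @ [b]))"
      using srt unfolding P
      by (cases "region_forward r"; cases "forward \<gamma>") (auto simp: sorted_wrt_append sorted_wrt_rev)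
    have "set (a # M @ [b]) = region_points p (insert \<beta> D) (Some \<beta>)"
      unfolding pts(2) set_P[symmetric] P using ord by fastforce
    then show "set (if forward \<gamma> then a # M @ [b] else rev (a # M @ [b])) =
        region_points p (insert \<beta> D) (Some \<beta>)"
      by auto
  qed
  show ?thesis using that[OF P[unfolded P_def] len 1 2] .
qed

text \<open>Identifies the factors of one term of the differential of a letter with two letters of
  the finer dissection.\<close>

lemma region_polygon_cut:
  assumes D: "D \<in> dissections p" and r: "r \<in> regions D"
    and \<gamma>: "\<gamma> \<in> nontrivial_arrows (region_polygon p D r)"
  defines "\<beta> \<equiv> path_arrow (region_path p D r) \<gamma>"
  shows "region_polygon p (insert \<beta> D) r = root_part (region_polygon p D r) \<gamma>"
    and "region_polygon p (insert \<beta> D) (Some \<beta>) = cut_part (region_polygon p D r) \<gamma>"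
proof -
  have "\<beta> \<in> addable_arrows p D r"
    using bij_betw_path_arrow[OF D r] \<gamma> unfolding \<beta>_def by (rule bij_betwE[rule_format])
  then have E: "insert \<beta> D \<in> dissections p" by (simp add: addable_arrows_def)
  obtain A a M b C where P: "region_path p D r = A @ a # M @ b # C"
    "length A = lo \<gamma>" "length A + length M + 1 = hi \<gamma>"
    "region_path p (insert \<beta> D) r = A @ a # b # C"
    "region_path p (insert \<beta> D) (Some \<beta>) = (if forward \<gamma> then a # M @ [b] else rev (a # M @ [b]))"
    using region_path_cut[OF D r \<gamma>] unfolding \<beta>_def by metis
  have s: "1 \<le> snd \<gamma>" using \<gamma> by (simp add: nontrivial_arrows_iff)
  note cut = odd_sides_cut[OF region_path_parity(1)[OF D r] P(1) s P(2,3), of p]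
  have "r \<in> regions (insert \<beta> D)" using r by (auto simp: regions_def)
  then show "region_polygon p (insert \<beta> D) r = root_part (region_polygon p D r) \<gamma>"
    using cut(1) P(4) by (simp only: region_polygon_eq[OF E] region_polygon_eq[OF D r])
  show "region_polygon p (insert \<beta> D) (Some \<beta>) = cut_part (region_polygon p D r) \<gamma>"
    using cut(2) P(5) by (simp only: region_polygon_eq[OF E] region_polygon_eq[OF D r] regions_simps insertI1)
qed

lemma region_polygon_insert_other:
  assumes "insert \<beta> D \<in> dissections p" "r \<in> regions D" "\<beta> \<notin> D"
    "\<beta> \<in> outer_arrows (insert \<beta> D) r" "s \<in> regions D" "s \<noteq> r"
  shows "region_polygon p (insert \<beta> D) s = region_polygon p D s"
proof -
  have "D \<in> dissections p" "s \<in> regions (insert \<beta> D)"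
    using dissections_subset[OF assms(1)] assms(5) by (auto simp: regions_def)
  then show ?thesis
    using region_points_insert(3)[OF assms(1-6)] assms
    by (simp add: region_polygon_eq region_path_def)
qed

section \<open>Weights and signs under cutting\<close>

text \<open>The parts have one side more in total than \<open>q\<close>, and the weight is the
  number of sides minus one. For a backward arrow from \<open>v_k\<close> to \<open>a_l\<close> the
  exponent \<open>k - l\<close> is the weight of the cut part.\<close>

lemma weight_cut:
  assumes "\<gamma> \<in> nontrivial_arrows q"
  shows "weight (root_part q \<gamma>) + weight (cut_part q \<gamma>) = weight q"
    and "arrow_sgn \<gamma> = (if forward \<gamma> then 1 else (-1) ^ weight (cut_part q \<gamma>))"
proof -
  have s: "1 \<le> snd \<gamma>" and g: "lo \<gamma> + 3 \<le> hi \<gamma>" "hi \<gamma> \<le> 2 * weight q + 1"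
    using assms by (auto simp: nontrivial_arrows_iff)
  define n where "n = weight q"
  have "n \<noteq> 0" using g by (simp add: n_def)
  then have q: "length q = n + 1" by (simp add: n_def weight_def)
  have "weight (root_part q \<gamma>) + weight (cut_part q \<gamma>) = n \<and>
    arrow_sgn \<gamma> = (if forward \<gamma> then 1 else (-1) ^ weight (cut_part q \<gamma>))"
    using g(1) g(2)[folded n_def] q
    by (cases rule: lo_hi_cases[OF s])
      (simp_all add: weight_def root_part_def cut_part_def arrow_sgn_def min_def)
  then show "weight (root_part q \<gamma>) + weight (cut_part q \<gamma>) = weight q"
    and "arrow_sgn \<gamma> = (if forward \<gamma> then 1 else (-1) ^ weight (cut_part q \<gamma>))"
    by (simp_all add: n_def)
qed

lemma dissection_sgn_insert:
  assumes D: "D \<in> dissections p" and r: "r \<in> regions D"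
    and \<gamma>: "\<gamma> \<in> nontrivial_arrows (region_polygon p D r)"
  defines "\<beta> \<equiv> path_arrow (region_path p D r) \<gamma>"
  shows "dissection_sgn p (insert \<beta> D) = dissection_sgn p D * arrow_sgn \<gamma>"
proof -
  \<comment> \<open>Forward regions and the root region get the factor 1, so the sign becomes a
    product over the whole dissection and the root needs no exception in \<open>key\<close>.\<close>
  define g :: "arrow set \<Rightarrow> region \<Rightarrow> rat" where
    "g E s = (if region_forward s then 1 else (-1) ^ weight (region_polygon p E s))" for E s
  have "\<beta> \<in> addable_arrows p D r"
    using bij_betw_path_arrow[OF D r] \<gamma> unfolding \<beta>_def by (rule bij_betwE[rule_format])
  then have \<beta>: "\<beta> \<notin> D" "insert \<beta> D \<in> dissections p" "\<beta> \<in> outer_arrows (insert \<beta> D) r"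
    by (auto simp: addable_arrows_def)
  have fin: "finite D" using finite_dissection[OF D] .
  have sgn: "dissection_sgn p E = (\<Prod>\<alpha>\<in>E. g E (Some \<alpha>))" if "finite E" for E
    unfolding dissection_sgn_def using that
    by (intro prod.mono_neutral_cong_left) (auto simp: g_def region_forward_def)
  have fwd: "region_forward (Some \<beta>) \<longleftrightarrow> (forward \<gamma> \<longleftrightarrow> region_forward r)"
    using path_arrow_props(8)[OF D r \<gamma>] by (simp add: region_forward_def \<beta>_def)
  note wc = weight_cut[OF \<gamma>] and rc = region_polygon_cut[OF D r \<gamma>, folded \<beta>_def]
  \<comment> \<open>If \<open>r\<close> is forward, the new factor alone is
    \<open>arrow_sgn \<gamma>\<close>. If \<open>r\<close> is backward, its old factor is the
    product of the factors of both parts; a forward \<gamma> uses both, a backward \<gamma> uses the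
    root part and squares the other away.\<close>
  have key: "g (insert \<beta> D) (Some \<beta>) * g (insert \<beta> D) r = g D r * arrow_sgn \<gamma>"
  proof -
    have pw: "(-1) ^ weight (region_polygon p D r) =
      (-1) ^ weight (root_part (region_polygon p D r) \<gamma>) * (-1 :: rat) ^ weight (cut_part (region_polygon p D r) \<gamma>)"
      unfolding wc(1)[symmetric] by (rule power_add)
    have sq: "(-1) ^ n * (-1) ^ n = (1::rat)" for n
      by (simp add: power_mult_distrib[symmetric])
    show ?thesis
      unfolding g_def fwd rc wc(2) pw by (auto simp: mult.assoc sq)
  qed
  have oth: "g (insert \<beta> D) s = g D s" if "s \<in> regions D" "s \<noteq> r" for s
    using region_polygon_insert_other[OF \<beta>(2) r \<beta>(1,3) that] by (simp add: g_def)
  have "(\<Prod>\<alpha>\<in>insert \<beta> D. g (insert \<beta> D) (Some \<alpha>)) =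
      g (insert \<beta> D) (Some \<beta>) * (\<Prod>\<alpha>\<in>D. g (insert \<beta> D) (Some \<alpha>))"
    using fin \<beta>(1) by simp
  also have "\<dots> = (\<Prod>\<alpha>\<in>D. g D (Some \<alpha>)) * arrow_sgn \<gamma>"
  proof (cases r)
    case None
    have "(\<Prod>\<alpha>\<in>D. g (insert \<beta> D) (Some \<alpha>)) = (\<Prod>\<alpha>\<in>D. g D (Some \<alpha>))"
      using None by (intro prod.cong oth) auto
    moreover have "g (insert \<beta> D) r = 1" "g D r = 1"
      using None by (simp_all add: g_def region_forward_def)
    ultimately show ?thesis using key by simp
  next
    case (Some \<alpha>)
    then have "\<alpha> \<in> D" using r by simp
    have "(\<Prod>\<delta>\<in>D - {\<alpha>}. g (insert \<beta> D) (Some \<delta>)) = (\<Prod>\<delta>\<in>D - {\<alpha>}. g D (Some \<delta>))"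
      using Some by (intro prod.cong oth) auto
    then show ?thesis
      using key Some by (simp add: prod.remove[OF fin \<open>\<alpha> \<in> D\<close>] mult_ac)
  qed
  finally show ?thesis using fin by (simp add: sgn)
qed

section \<open>The differentials of the bar element\<close>

lemma lin_ext_sum: "lin_ext F (sum f A) = (\<Sum>a\<in>A. lin_ext F (f a))"
  by (induction A rule: infinite_finite_induct) (simp_all add: lin_ext_add)

lemma scale_minus: "scale (-1) f = - f"
  by (rule poly_mapping_eqI) simp

lemma lin_ext_minus: "lin_ext F (- f) = - lin_ext F f"
  using lin_ext_scale[of F "-1" f] by (simp add: scale_minus)

lemma scale_uminus: "scale c (- f) = - scale c f"
  by (rule poly_mapping_eqI) simp

lemma eq_minus_self_zero: "f = - f \<Longrightarrow> f = (0 :: 'a \<Rightarrow>\<^sub>0 rat)"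
proof (rule poly_mapping_eqI)
  fix x assume "f = - f"
  then have "Poly_Mapping.lookup f x = - Poly_Mapping.lookup f x"
    by (metis lookup_uminus)
  then show "Poly_Mapping.lookup f x = Poly_Mapping.lookup 0 x" by simp
qed

lemma bar_insert_scale: "bar_insert u (scale c y) v = scale c (bar_insert u y v)"
  by (simp add: bar_insert_def lin_ext_scale)

lemma bar_insert_sum: "bar_insert u (sum f A) v = (\<Sum>a\<in>A. bar_insert u (f a) v)"
  by (simp add: bar_insert_def lin_ext_sum)

lemma bar_insert_minus: "bar_insert u (- y) v = - bar_insert u y v"
  by (simp add: bar_insert_def lin_ext_minus)

lemma finite_addable_arrows:
  "D \<in> dissections p \<Longrightarrow> r \<in> regions D \<Longrightarrow> finite (addable_arrows p D r)"
  using bij_betw_finite[OF bij_betw_path_arrow] by fastforce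

text \<open>All arrows splitting \<open>r\<close> together turn a pair of adjacent letters into the
  differential of one letter, which is how a term of \<open>bar_D2\<close> arises.\<close>

lemma del_region_polygon:
  assumes D: "D \<in> dissections p" and r: "r \<in> regions D"
  shows "(\<Sum>\<beta>\<in>addable_arrows p D r. scale (dissection_sgn p (insert \<beta> D))
      (gen (region_polygon p (insert \<beta> D) r) \<and>\<^sub>e gen (region_polygon p (insert \<beta> D) (Some \<beta>)))) =
    scale (dissection_sgn p D) (del_polygon (region_polygon p D r))"
  unfolding sum.reindex_bij_betw[OF bij_betw_path_arrow[OF D r], symmetric] del_polygon_def scale_sum
  by (rule sum.cong)
    (simp_all add: dissection_sgn_insert[OF D r] region_polygon_cut[OF D r])

text \<open>A word with a marked letter is a decomposition instead of an index, so that inserting,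
  removing and swapping letters needs no index arithmetic.\<close>

definition splits1 :: "'a list set \<Rightarrow> ('a list \<times> 'a \<times> 'a list) set" where
  "splits1 A = {(u, x, v). u @ x # v \<in> A}"

definition splits2 :: "'a list set \<Rightarrow> ('a list \<times> 'a \<times> 'a \<times> 'a list) set" where
  "splits2 A = {(u, x, y, v). u @ x # y # v \<in> A}"

lemma splits1_iff [simp]: "(u, x, v) \<in> splits1 A \<longleftrightarrow> u @ x # v \<in> A"
  by (simp add: splits1_def)

lemma splits2_iff [simp]: "(u, x, y, v) \<in> splits2 A \<longleftrightarrow> u @ x # y # v \<in> A"
  by (simp add: splits2_def)

lemma finite_splits:
  assumes "finite A"
  shows "finite (splits1 A)" "finite (splits2 A)"
proof -
  have "(u, x, v) \<in> (\<lambda>(w, j). (take j w, w ! j, drop (Suc j) w)) ` (SIGMA w:A. {..<length w})"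
    if "u @ x # v \<in> A" for u x v
    using that by (intro image_eqI[of _ _ "(u @ x # v, length u)"]) auto
  then have "splits1 A \<subseteq> (\<lambda>(w, j). (take j w, w ! j, drop (Suc j) w)) ` (SIGMA w:A. {..<length w})"
    unfolding splits1_def by blast
  then show "finite (splits1 A)" by (rule finite_subset) (use assms in auto)
  have "(u, x, y, v) \<in> (\<lambda>(w, j). (take j w, w ! j, w ! Suc j, drop (Suc (Suc j)) w)) ` (SIGMA w:A. {..<length w})"
    if "u @ x # y # v \<in> A" for u x y v
    using that by (intro image_eqI[of _ _ "(u @ x # y # v, length u)"]) (auto simp: nth_append)
  then have "splits2 A \<subseteq> (\<lambda>(w, j). (take j w, w ! j, w ! Suc j, drop (Suc (Suc j)) w)) ` (SIGMA w:A. {..<length w})"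
    unfolding splits2_def by blast
  then show "finite (splits2 A)" by (rule finite_subset) (use assms in auto)
qed

lemma sum_splits1:
  assumes "finite A"
  shows "(\<Sum>w\<in>A. \<Sum>j = 1..length w. F (take (j - 1) w) (w ! (j - 1)) (drop j w)) =
    (\<Sum>(u, x, v)\<in>splits1 A. F u x v)"
proof -
  have "(\<Sum>w\<in>A. \<Sum>j = 1..length w. F (take (j - 1) w) (w ! (j - 1)) (drop j w)) =
    (\<Sum>(w, j)\<in>(SIGMA w:A. {1..length w}). F (take (j - 1) w) (w ! (j - 1)) (drop j w))"
    using assms by (intro sum.Sigma) auto
  also have "\<dots> = (\<Sum>(u, x, v)\<in>splits1 A. F u x v)"
  proof (rule sum.reindex_bij_witness[where i = "\<lambda>(u, x, v). (u @ x # v, length u + 1)"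
        and j = "\<lambda>(w, j). (take (j - 1) w, w ! (j - 1), drop j w)"])
    fix a assume "a \<in> (SIGMA w:A. {1..length w})"
    then obtain w j where a: "a = (w, Suc j)" "w \<in> A" "j < length w"
      by (cases a) (auto simp: Suc_le_eq dest!: gr0_implies_Suc)
    then have "w = take j w @ w ! j # drop (Suc j) w" by (simp add: id_take_nth_drop)
    with a show "(case case a of (w, j) \<Rightarrow> (take (j - 1) w, w ! (j - 1), drop j w) of
         (u, x, v) \<Rightarrow> (u @ x # v, length u + 1)) = a"
      and "(case a of (w, j) \<Rightarrow> (take (j - 1) w, w ! (j - 1), drop j w)) \<in> splits1 A"
      by simp_all
  qed (auto simp: splits1_def)
  finally show ?thesis .
qed

lemma sum_splits2:
  assumes "finite A"
  shows "(\<Sum>w\<in>A. \<Sum>j = 1..<length w. F (take (j - 1) w) (w ! (j - 1)) (w ! j) (drop (j + 1) w)) =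
    (\<Sum>(u, x, y, v)\<in>splits2 A. F u x y v)"
proof -
  have "(\<Sum>w\<in>A. \<Sum>j = 1..<length w. F (take (j - 1) w) (w ! (j - 1)) (w ! j) (drop (j + 1) w)) =
    (\<Sum>(w, j)\<in>(SIGMA w:A. {1..<length w}). F (take (j - 1) w) (w ! (j - 1)) (w ! j) (drop (j + 1) w))"
    using assms by (intro sum.Sigma) auto
  also have "\<dots> = (\<Sum>(u, x, y, v)\<in>splits2 A. F u x y v)"
  proof (rule sum.reindex_bij_witness[where i = "\<lambda>(u, x, y, v). (u @ x # y # v, length u + 1)"
        and j = "\<lambda>(w, j). (take (j - 1) w, w ! (j - 1), w ! j, drop (j + 1) w)"])
    fix a assume "a \<in> (SIGMA w:A. {1..<length w})"
    then obtain w j where a: "a = (w, Suc j)" "w \<in> A" "Suc j < length w"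
      by (cases a) (auto simp: Suc_le_eq dest!: gr0_implies_Suc)
    then have "w = take j w @ w ! j # w ! Suc j # drop (Suc (Suc j)) w"
      by (simp add: Cons_nth_drop_Suc Suc_lessD)
    with a show "(case case a of (w, j) \<Rightarrow> (take (j - 1) w, w ! (j - 1), w ! j, drop (j + 1) w) of
         (u, x, y, v) \<Rightarrow> (u @ x # y # v, length u + 1)) = a"
      and "(case a of (w, j) \<Rightarrow> (take (j - 1) w, w ! (j - 1), w ! j, drop (j + 1) w)) \<in> splits2 A"
      by simp_all
  qed (auto simp: splits2_def nth_append)
  finally show ?thesis .
qed

section \<open>The words of a dissection and their differentials\<close>

definition region_word :: "'r list \<Rightarrow> arrow set \<Rightarrow> region list \<Rightarrow> 'r list fset list" where
  "region_word p D rs = map (\<lambda>r. {|region_polygon p D r|}) rs"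

lemma length_region_word [simp]: "length (region_word p D rs) = length rs"
  by (simp add: region_word_def)

text \<open>Each letter is a generator of exterior degree 1 and contributes \<open>1 - 1\<close>, so
  all signs depending on word degrees become 1.\<close>

lemma word_degree_region_word [simp]: "word_degree (region_word p D rs) = 0"
  by (induction rs) (simp_all add: region_word_def word_degree_def fcard.rep_eq)

lemma take_drop_region_word:
  "take n (region_word p D rs) = region_word p D (take n rs)"
  "drop n (region_word p D rs) = region_word p D (drop n rs)"
  by (simp_all add: region_word_def take_map drop_map)

lemma bar_D1_bar_element:
  "bar_D1 (bar_element p) = - (\<Sum>D\<in>dissections p. \<Sum>(u, r, s, v)\<in>splits2 (compatible_orders D).
     scale (dissection_sgn p D) (bar_insert (region_word p D u)
       (gen (region_polygon p D r) \<and>\<^sub>e gen (region_polygon p D s)) (region_word p D v)))"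
proof -
  let ?G = "\<lambda>D u r s v. bar_insert (region_word p D u)
       (gen (region_polygon p D r) \<and>\<^sub>e gen (region_polygon p D s)) (region_word p D v)"
  have *: "bar_D1 (basis (region_word p D rs)) =
    - (\<Sum>j = 1..<length rs. ?G D (take (j - 1) rs) (rs ! (j - 1)) (rs ! j) (drop (j + 1) rs))" for D rs
  proof -
    have "basis (region_word p D rs ! j) = gen (region_polygon p D (rs ! j))" if "j < length rs" for j
      using that by (simp add: region_word_def gen_def)
    then show ?thesis
      unfolding bar_D1_def lin_ext_basis
      by (intro arg_cong[of _ _ uminus] sum.cong)
        (auto simp: take_drop_region_word Suc_le_eq gr0_conv_Suc simp del: wedge_basis_basis)
  qed
  have "bar_D1 (bar_element p) = (\<Sum>D\<in>dissections p. scale (dissection_sgn p D)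
      (\<Sum>rs\<in>compatible_orders D. bar_D1 (basis (region_word p D rs))))"
    unfolding bar_element_def region_word_def[symmetric] bar_D1_def
    by (simp only: lin_ext_sum lin_ext_scale)
  also have "\<dots> = (\<Sum>D\<in>dissections p. - (\<Sum>(u, r, s, v)\<in>splits2 (compatible_orders D).
      scale (dissection_sgn p D) (?G D u r s v)))"
  proof (rule sum.cong)
    fix D assume "D \<in> dissections p"
    then have fin: "finite (compatible_orders D)"
      using finite_compatible_orders finite_dissection by blast
    show "scale (dissection_sgn p D) (\<Sum>rs\<in>compatible_orders D. bar_D1 (basis (region_word p D rs))) =
       - (\<Sum>(u, r, s, v)\<in>splits2 (compatible_orders D). scale (dissection_sgn p D) (?G D u r s v))"
      unfolding * sum_negf scale_uminus scale_sum
      using sum_splits2[OF fin, of "\<lambda>u r s v. scale (dissection_sgn p D) (?G D u r s v)"] by simp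
  qed simp
  finally show ?thesis by (simp add: sum_negf)
qed

lemma bar_D2_bar_element:
  "bar_D2 (bar_element p) = (\<Sum>D\<in>dissections p. \<Sum>(u, r, v)\<in>splits1 (compatible_orders D).
     scale (dissection_sgn p D) (bar_insert (region_word p D u)
       (del_polygon (region_polygon p D r)) (region_word p D v)))"
proof -
  let ?G = "\<lambda>D u r v. bar_insert (region_word p D u)
       (del_polygon (region_polygon p D r)) (region_word p D v)"
  have *: "bar_D2 (basis (region_word p D rs)) =
    (\<Sum>j = 1..length rs. ?G D (take (j - 1) rs) (rs ! (j - 1)) (drop j rs))" for D rs
  proof -
    have "del (basis (region_word p D rs ! j)) = del_polygon (region_polygon p D (rs ! j))" if "j < length rs" for j
      using that by (simp add: region_word_def gen_def[symmetric] del_gen)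
    then show ?thesis
      unfolding bar_D2_def lin_ext_basis
      by (intro sum.cong)
        (auto simp: take_drop_region_word Suc_le_eq gr0_conv_Suc)
  qed
  have "bar_D2 (bar_element p) = (\<Sum>D\<in>dissections p. scale (dissection_sgn p D)
      (\<Sum>rs\<in>compatible_orders D. bar_D2 (basis (region_word p D rs))))"
    unfolding bar_element_def region_word_def[symmetric] bar_D2_def
    by (simp only: lin_ext_sum lin_ext_scale)
  also have "\<dots> = (\<Sum>D\<in>dissections p. (\<Sum>(u, r, v)\<in>splits1 (compatible_orders D).
      scale (dissection_sgn p D) (?G D u r v)))"
  proof (rule sum.cong)
    fix D assume "D \<in> dissections p"
    then have fin: "finite (compatible_orders D)"
      using finite_compatible_orders finite_dissection by blast
    show "scale (dissection_sgn p D) (\<Sum>rs\<in>compatible_orders D. bar_D2 (basis (region_word p D rs))) =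
       (\<Sum>(u, r, v)\<in>splits1 (compatible_orders D). scale (dissection_sgn p D) (?G D u r v))"
      unfolding * scale_sum
      using sum_splits1[OF fin, of "\<lambda>u r v. scale (dissection_sgn p D) (?G D u r v)"] by simp
  qed simp
  finally show ?thesis .
qed

section \<open>Cancelling and pairing adjacent letters\<close>

lemma compatible_orders_swap:
  assumes D: "D \<in> dissections p" and c: "u @ r # s # v \<in> compatible_orders D" and "\<not> region_lt r s"
  shows "u @ s # r # v \<in> compatible_orders D" "\<not> region_lt s r"
  using c assms(3) by (auto simp: compatible_orders_iff[OF D] sorted_wrt_append)

text \<open>Swapping the two marked letters is an involution of the index set that negates each
  term; over the rationals a sum equal to its negative vanishes.\<close>

lemma sum_incomparable_zero:
  assumes D: "D \<in> dissections p"
    and anti: "\<And>u r s v. (F u s r v :: 'b \<Rightarrow>\<^sub>0 rat) = - F u r s v"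
  shows "(\<Sum>(u, r, s, v)\<in>{(u, r, s, v). (u, r, s, v) \<in> splits2 (compatible_orders D) \<and> \<not> region_lt r s}. F u r s v) = 0"
    (is "sum ?F ?S = 0")
proof (rule eq_minus_self_zero)
  have "sum ?F ?S = (\<Sum>(u, r, s, v)\<in>?S. F u s r v)"
    by (rule sum.reindex_bij_witness[where i = "\<lambda>(u, r, s, v). (u, s, r, v)" and j = "\<lambda>(u, r, s, v). (u, s, r, v)"])
      (auto dest: compatible_orders_swap[OF D])
  also have "\<dots> = - sum ?F ?S"
    unfolding sum_negf[symmetric] by (rule sum.cong) (auto simp: anti[symmetric])
  finally show "sum ?F ?S = - sum ?F ?S" .
qed

text \<open>Comparable neighbours in a compatible order are joined by an edge of the tree. Removing
  a letter keeps the order compatible since \<open>region_lt\<close> is the same for the smaller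
  dissection.\<close>

lemma compatible_orders_remove:
  assumes D: "D \<in> dissections p" and c: "u @ r # Some \<beta> # v \<in> compatible_orders D" and lt: "region_lt r (Some \<beta>)"
  shows "\<beta> \<in> D" "u @ r # v \<in> compatible_orders (D - {\<beta>})" "\<beta> \<in> outer_arrows D r" "r \<in> regions (D - {\<beta>})"
proof -
  have c': "distinct (u @ r # Some \<beta> # v)" "set (u @ r # Some \<beta> # v) = regions D"
    "sorted_wrt (\<lambda>r s. \<not> region_lt s r) (u @ r # Some \<beta> # v)"
    using c by (simp_all only: compatible_orders_iff[OF D])
  have "Some \<beta> \<in> regions D" "r \<in> regions D" unfolding c'(2)[symmetric] by auto
  then show "\<beta> \<in> D" by simp
  have D': "D - {\<beta>} \<in> dissections p" by (rule dissections_subset[OF D Diff_subset])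
  have reg: "regions (D - {\<beta>}) = regions D - {Some \<beta>}" by (auto simp: regions_def)
  have "set (u @ r # v) = regions (D - {\<beta>})"
    unfolding reg c'(2)[symmetric] using c'(1) by auto
  then show "r \<in> regions (D - {\<beta>})" "u @ r # v \<in> compatible_orders (D - {\<beta>})"
    using c'(1,3) by (auto simp: compatible_orders_iff[OF D'] sorted_wrt_append)
  \<comment> \<open>An arrow strictly between \<open>r\<close> and \<beta> would have to stand
    between the two letters, which are adjacent.\<close>
  have "\<not> beyond \<gamma> \<beta>" if \<gamma>: "\<gamma> \<in> D" "region_lt r (Some \<gamma>)" for \<gamma>
  proof
    assume b: "beyond \<gamma> \<beta>"
    have "Some \<gamma> \<in> set (u @ r # Some \<beta> # v)" unfolding c'(2) using \<gamma> by simp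
    then consider "Some \<gamma> \<in> set u" | "Some \<gamma> = r" | "\<gamma> = \<beta>" | "Some \<gamma> \<in> set v" by auto
    then show False
    proof cases
      case 1
      then show ?thesis using c'(3) \<gamma> by (auto simp: sorted_wrt_append)
    next
      case 2
      then show ?thesis using \<gamma> region_lt_irrefl by blast
    next
      case 3
      then show ?thesis using b by (simp add: beyond_def)
    next
      case 4
      then have "\<not> region_lt (Some \<gamma>) (Some \<beta>)" using c'(3) by (auto simp: sorted_wrt_append)
      then show ?thesis using b by simp
    qed
  qed
  then show "\<beta> \<in> outer_arrows D r"
    using lt \<open>\<beta> \<in> D\<close> by (auto simp: outer_arrows_def arrows_beyond_eq)
qed

text \<open>A letter that must follow \<open>Some \<beta>\<close> must also follow \<open>r\<close>,
  so none stands in \<open>u\<close>. Those that must precede it are \<open>r\<close> and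
  predecessors of \<open>r\<close>, so none stands in \<open>v\<close>.\<close>

lemma compatible_orders_insert:
  assumes D: "D \<in> dissections p" and c: "u @ r # v \<in> compatible_orders D" and \<beta>: "\<beta> \<in> addable_arrows p D r"
  shows "u @ r # Some \<beta> # v \<in> compatible_orders (insert \<beta> D)" "region_lt r (Some \<beta>)"
proof -
  have E: "insert \<beta> D \<in> dissections p" and "\<beta> \<notin> D" and o: "\<beta> \<in> outer_arrows (insert \<beta> D) r"
    using \<beta> by (auto simp: addable_arrows_def)
  have c': "distinct (u @ r # v)" "set (u @ r # v) = regions D"
    "sorted_wrt (\<lambda>r s. \<not> region_lt s r) (u @ r # v)"
    using c by (simp_all only: compatible_orders_iff[OF D])
  show lt: "region_lt r (Some \<beta>)" using o by (auto simp: outer_arrows_def arrows_beyond_eq)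
  have reg: "regions (insert \<beta> D) = insert (Some \<beta>) (regions D)" by (auto simp: regions_def)
  have r: "r \<in> regions (insert \<beta> D)" and \<beta>r: "Some \<beta> \<in> regions (insert \<beta> D)"
    unfolding reg c'(2)[symmetric] by auto
  have mem: "x \<in> regions (insert \<beta> D)" if "x \<in> set u \<union> set v" for x
    unfolding reg c'(2)[symmetric] using that by auto
  have "\<not> region_lt (Some \<beta>) x" if "x \<in> set u" for x
  proof
    assume "region_lt (Some \<beta>) x"
    then have "region_lt r x" using region_lt_trans[OF E r \<beta>r mem lt] that by blast
    then show False using c'(3) that by (auto simp: sorted_wrt_append)
  qed
  moreover have "\<not> region_lt (Some \<beta>) r" using region_lt_asym[OF E r \<beta>r lt] .
  moreover have "\<not> region_lt y (Some \<beta>)" if "y \<in> set v" for y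
  proof
    assume "region_lt y (Some \<beta>)"
    then have "y = r \<or> region_lt y r" using region_lt_outer_arrow[OF E r mem o] that by blast
    then show False using c'(1,3) that by (auto simp: sorted_wrt_append)
  qed
  ultimately have "sorted_wrt (\<lambda>r s. \<not> region_lt s r) (u @ r # Some \<beta> # v)"
    using c'(3) by (simp add: sorted_wrt_append)
  moreover have "Some \<beta> \<notin> set (u @ r # v)" unfolding c'(2) using \<open>\<beta> \<notin> D\<close> by simp
  then have "distinct (u @ r # Some \<beta> # v)" using c'(1) by auto
  moreover have "set (u @ r # Some \<beta> # v) = regions (insert \<beta> D)"
    unfolding reg c'(2)[symmetric] by auto
  ultimately show "u @ r # Some \<beta> # v \<in> compatible_orders (insert \<beta> D)"
    unfolding compatible_orders_iff[OF E] by blast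
qed

lemma sum_cover_pairs:
  "(\<Sum>D\<in>dissections p. \<Sum>(u, r, s, v)\<in>{(u, r, s, v). (u, r, s, v) \<in> splits2 (compatible_orders D) \<and> region_lt r s}.
      F D u r s v) =
   (\<Sum>D\<in>dissections p. \<Sum>(u, r, v)\<in>splits1 (compatible_orders D). \<Sum>\<beta>\<in>addable_arrows p D r.
      F (insert \<beta> D) u r (Some \<beta>) v)"
  (is "(\<Sum>D\<in>_. sum _ (?S D)) = _")
proof -
  have fin: "finite (splits2 (compatible_orders D))" "finite (splits1 (compatible_orders D))"
    if "D \<in> dissections p" for D
    using finite_splits[OF finite_compatible_orders[OF finite_dissection[OF that]]] by blast+
  have finS: "finite (?S D)" if "D \<in> dissections p" for D
    by (rule finite_subset[OF _ fin(1)[OF that]]) auto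
  have add: "finite (addable_arrows p D r)"
    if "D \<in> dissections p" "u @ r # v \<in> compatible_orders D" for D u r v
    using that by (intro finite_addable_arrows) (auto simp: compatible_orders_iff)
  let ?T = "SIGMA D:dissections p. SIGMA (u, r, v):splits1 (compatible_orders D). addable_arrows p D r"
  have "(\<Sum>D\<in>dissections p. \<Sum>(u, r, s, v)\<in>?S D. F D u r s v) =
     (\<Sum>(D, u, r, s, v)\<in>(SIGMA D:dissections p. ?S D). F D u r s v)"
    using finS by (simp add: sum.Sigma)
  also have "\<dots> = (\<Sum>(D, (u, r, v), \<beta>)\<in>?T. F (insert \<beta> D) u r (Some \<beta>) v)"
  \<comment> \<open>Inserting and deleting the arrow are mutually inverse because
    \<open>addable_arrows\<close> includes that \<beta> is not in \<open>D\<close>.\<close>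
  proof (rule sum.reindex_bij_witness[where
        j = "\<lambda>(D, u, r, s, v). (D - {the s}, (u, r, v), the s)" and
        i = "\<lambda>(D, (u, r, v), \<beta>). (insert \<beta> D, u, r, Some \<beta>, v)"])
    fix a assume "a \<in> (SIGMA D:dissections p. ?S D)"
    then obtain D u r s v where a: "a = (D, u, r, s, v)" "D \<in> dissections p"
      "u @ r # s # v \<in> compatible_orders D" "region_lt r s"
      by auto
    then obtain \<beta> where s: "s = Some \<beta>" by (cases s) auto
    note rem = compatible_orders_remove[OF a(2) a(3,4)[unfolded s]]
    have "insert \<beta> (D - {\<beta>}) = D" using rem(1) by blast
    then show "(\<lambda>(D, (u, r, v), \<beta>). (insert \<beta> D, u, r, Some \<beta>, v)) ((\<lambda>(D, u, r, s, v). (D - {the s}, (u, r, v), the s)) a) = a"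
      and "(\<lambda>(D, u, r, s, v). (D - {the s}, (u, r, v), the s)) a \<in> ?T"
      and "(\<lambda>(D, (u, r, v), \<beta>). F (insert \<beta> D) u r (Some \<beta>) v) ((\<lambda>(D, u, r, s, v). (D - {the s}, (u, r, v), the s)) a) =
        (\<lambda>(D, u, r, s, v). F D u r s v) a"
      using a s rem dissections_subset[OF a(2), of "D - {\<beta>}"] by (auto simp: addable_arrows_def)
  next
    fix b assume "b \<in> ?T"
    then obtain D u r v \<beta> where b: "b = (D, (u, r, v), \<beta>)" "D \<in> dissections p"
      "u @ r # v \<in> compatible_orders D" "\<beta> \<in> addable_arrows p D r"
      by auto
    have "insert \<beta> D \<in> dissections p" "\<beta> \<notin> D" using b(4) by (auto simp: addable_arrows_def)
    then show "(\<lambda>(D, u, r, s, v). (D - {the s}, (u, r, v), the s)) ((\<lambda>(D, (u, r, v), \<beta>). (insert \<beta> D, u, r, Some \<beta>, v)) b) = b"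
      and "(\<lambda>(D, (u, r, v), \<beta>). (insert \<beta> D, u, r, Some \<beta>, v)) b \<in> (SIGMA D:dissections p. ?S D)"
      using b compatible_orders_insert[OF b(2-4)] by auto
  qed
  also have "\<dots> = (\<Sum>D\<in>dissections p. \<Sum>((u, r, v), \<beta>)\<in>(SIGMA (u, r, v):splits1 (compatible_orders D). addable_arrows p D r).
      F (insert \<beta> D) u r (Some \<beta>) v)"
    using fin add
    by (subst sum.Sigma) (auto intro!: finite_SigmaI)
  also have "\<dots> = (\<Sum>D\<in>dissections p. \<Sum>(u, r, v)\<in>splits1 (compatible_orders D). \<Sum>\<beta>\<in>addable_arrows p D r.
      F (insert \<beta> D) u r (Some \<beta>) v)"
  proof (rule sum.cong)
    fix D assume D: "D \<in> dissections p"
    show "(\<Sum>((u, r, v), \<beta>)\<in>(SIGMA (u, r, v):splits1 (compatible_orders D). addable_arrows p D r).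
      F (insert \<beta> D) u r (Some \<beta>) v) = (\<Sum>(u, r, v)\<in>splits1 (compatible_orders D). \<Sum>\<beta>\<in>addable_arrows p D r.
      F (insert \<beta> D) u r (Some \<beta>) v)"
    proof -
      have "\<forall>x\<in>splits1 (compatible_orders D). finite (case x of (u, r, v) \<Rightarrow> addable_arrows p D r)"
        using add[OF D] by auto
      from sum.Sigma[OF fin(2)[OF D] this,
          of "\<lambda>(u, r, v) \<beta>. F (insert \<beta> D) u r (Some \<beta>) v", symmetric]
      show ?thesis by (simp add: case_prod_unfold)
    qed
  qed simp
  finally show ?thesis .
qed

section \<open>Degree zero and the cocycle identity\<close>

text \<open>Ensures that each region has at least two sides. A path of two points would make the
  closing chord of the region a unit step, or else an arrow of \<open>D\<close> with the same chord,
  which is trivial for the root region and equal to \<alpha> for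
  \<open>Some \<alpha>\<close>.\<close>

lemma four_le_length_region_path:
  assumes p: "1 \<le> weight p" and D: "D \<in> dissections p" and r: "r \<in> regions D"
  shows "4 \<le> length (region_path p D r)"
proof (rule ccontr)
  let ?P = "region_path p D r"
  assume "\<not> 4 \<le> length ?P"
  moreover have "2 \<le> length ?P" "even (length ?P)"
    using region_path_ends(3)[OF D r] region_path_parity(2)[OF D r] by auto
  ultimately have l: "length ?P = 2" by presburger
  have b: "region_lo r < region_hi p r" using region_bounds(1)[OF D r] .
  have e: "min (?P ! 0) (?P ! Suc 0) = region_lo r" "max (?P ! 0) (?P ! Suc 0) = region_hi p r"
    using region_path_ends(1,2)[OF D r] l b by (cases "region_forward r"; simp)+
  have "region_hi p r = region_lo r + 1 \<or> (\<exists>\<beta>\<in>arrows_beyond D r. lo \<beta> = region_lo r \<and> hi \<beta> = region_hi p r)"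
    using region_path_consecutive[OF D r, of 0] l unfolding e by simp
  moreover have "region_hi p r \<noteq> region_lo r + 1"
  proof (cases r)
    case None
    then show ?thesis using p by (simp add: region_lo_def region_hi_def)
  next
    case (Some \<alpha>)
    then show ?thesis using dissectionD(2)[OF D, of \<alpha>] r by (simp add: region_lo_def region_hi_def)
  qed
  ultimately obtain \<beta> where \<beta>: "\<beta> \<in> arrows_beyond D r" "lo \<beta> = region_lo r" "hi \<beta> = region_hi p r" by blast
  then have "\<beta> \<in> D" "region_lt r (Some \<beta>)" by (auto simp: arrows_beyond_eq)
  show False
  proof (cases r)
    case None
    then show ?thesis using dissectionD(4)[OF D \<open>\<beta> \<in> D\<close>] \<beta> by (simp add: region_lo_def region_hi_def)
  next
    case (Some \<alpha>)
    then have "1 \<le> snd \<alpha>" "1 \<le> snd \<beta>" using r dissectionD(1)[OF D] \<open>\<beta> \<in> D\<close> by auto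
    then have "\<alpha> = \<beta>" using Some \<beta> by (intro lo_hi_inj) (auto simp: region_lo_def region_hi_def)
    then show ?thesis using Some \<open>region_lt r (Some \<beta>)\<close> region_lt_irrefl by blast
  qed
qed

lemma region_polygon_deco:
  assumes p: "p \<in> deco_polygons R" and D: "D \<in> dissections p" and r: "r \<in> regions D"
  shows "region_polygon p D r \<in> deco_polygons R"
proof -
  have w: "1 \<le> weight p" "length p = weight p + 1" and R: "set p \<subseteq> R"
    using p by (auto simp: deco_polygons_def weight_def)
  have "2 \<le> length (region_polygon p D r)"
    using four_le_length_region_path[OF w(1) D r] length_region_polygon(1)[OF D r] by simp
  moreover have "set (region_polygon p D r) \<subseteq> R"
  proof
    fix y assume "y \<in> set (region_polygon p D r)"
    then obtain x where x: "x \<in> region_points p D r" "y = p ! (x div 2)"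
      by (auto simp: region_polygon_eq[OF D r] odd_sides_def)
    have "x \<le> region_hi p r" using x by (simp add: region_points_def)
    also have "\<dots> \<le> 2 * weight p + 1" by (rule region_bounds(2)[OF D r])
    finally have "x div 2 < length p" using w by simp
    then show "y \<in> R" using x R nth_mem by blast
  qed
  ultimately show ?thesis by (simp add: deco_polygons_def)
qed

lemma bar_construction_add:
  "f \<in> bar_construction R d \<Longrightarrow> g \<in> bar_construction R d \<Longrightarrow> f + g \<in> bar_construction R d"
  using Poly_Mapping.keys_add[of f g] by (auto simp: bar_construction_def)

lemma bar_construction_sum:
  "(\<And>a. a \<in> A \<Longrightarrow> f a \<in> bar_construction R d) \<Longrightarrow> sum f A \<in> bar_construction R d"
proof (induction A rule: infinite_finite_induct)
  case (insert a A)
  then show ?case by (simp add: bar_construction_add)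
qed (simp_all add: bar_construction_def)

lemma bar_construction_scale:
  "f \<in> bar_construction R d \<Longrightarrow> scale c f \<in> bar_construction R d"
  by (auto simp: bar_construction_def in_keys_iff)

lemma bar_element_degree_0:
  assumes p: "p \<in> deco_polygons R"
  shows "bar_element p \<in> bar_construction R 0"
  unfolding bar_element_def region_word_def[symmetric]
proof (intro bar_construction_sum bar_construction_scale)
  fix D rs assume D: "D \<in> dissections p" and rs: "rs \<in> compatible_orders D"
  have "set rs = regions D" using rs by (simp add: compatible_orders_iff[OF D])
  then have "region_word p D rs \<in> bar_words R"
    using region_polygon_deco[OF p D] by (auto simp: bar_words_def region_word_def)
  then show "basis (region_word p D rs) \<in> bar_construction R 0"
    by (simp add: bar_construction_def basis_def)
qed

lemma bar_differential_bar_element: "bar_D1 (bar_element p) + bar_D2 (bar_element p) = 0"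
proof -
  define X where "X D u r s v = scale (dissection_sgn p D) (bar_insert (region_word p D u)
       (gen (region_polygon p D r) \<and>\<^sub>e gen (region_polygon p D s)) (region_word p D v))" for D u r s v
  let ?S = "\<lambda>D. splits2 (compatible_orders D)"
  let ?cov = "\<lambda>D. {(u, r, s, v). (u, r, s, v) \<in> ?S D \<and> region_lt r s}"
  let ?inc = "\<lambda>D. {(u, r, s, v). (u, r, s, v) \<in> ?S D \<and> \<not> region_lt r s}"
  have anti: "X D u s r v = - X D u r s v" for D u r s v
    unfolding X_def
    by (subst gen_wedge_anticommute) (simp add: bar_insert_minus scale_uminus)
  have "(\<Sum>(u, r, s, v)\<in>?S D. X D u r s v) = (\<Sum>(u, r, s, v)\<in>?cov D. X D u r s v)"
    if D: "D \<in> dissections p" for D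
  proof -
    have fin: "finite (?S D)"
      using finite_splits(2)[OF finite_compatible_orders[OF finite_dissection[OF D]]] .
    have "finite (?cov D)" "finite (?inc D)"
      by (rule finite_subset[OF _ fin]; auto)+
    moreover have "?cov D \<inter> ?inc D = {}" by auto
    ultimately have "(\<Sum>(u, r, s, v)\<in>?cov D \<union> ?inc D. X D u r s v) =
        (\<Sum>(u, r, s, v)\<in>?cov D. X D u r s v) + (\<Sum>(u, r, s, v)\<in>?inc D. X D u r s v)"
      by (rule sum.union_disjoint)
    moreover have "?cov D \<union> ?inc D = ?S D" by auto
    moreover have "(\<Sum>(u, r, s, v)\<in>?inc D. X D u r s v) = 0"
      by (rule sum_incomparable_zero[OF D anti])
    ultimately show ?thesis by simp
  qed
  then have "bar_D1 (bar_element p) = - (\<Sum>D\<in>dissections p. \<Sum>(u, r, s, v)\<in>?cov D. X D u r s v)"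
    unfolding bar_D1_bar_element X_def by simp
  also have "(\<Sum>D\<in>dissections p. \<Sum>(u, r, s, v)\<in>?cov D. X D u r s v) =
    (\<Sum>D\<in>dissections p. \<Sum>(u, r, v)\<in>splits1 (compatible_orders D).
       \<Sum>\<beta>\<in>addable_arrows p D r. X (insert \<beta> D) u r (Some \<beta>) v)"
    by (rule sum_cover_pairs)
  also have "\<dots> = bar_D2 (bar_element p)"
    unfolding bar_D2_bar_element
  proof (intro sum.cong refl, clarify)
    fix D u r v assume D: "D \<in> dissections p" and s: "(u, r, v) \<in> splits1 (compatible_orders D)"
    have urv: "set (u @ r # v) = regions D" "distinct (u @ r # v)"
      using s by (simp_all only: splits1_iff compatible_orders_iff[OF D])
    then have r: "r \<in> regions D" by auto
    \<comment> \<open>Splitting \<open>r\<close> leaves the polygons of the other letters unchanged,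
      so the outer parts of the word can be taken out of the sum over \<beta>.\<close>
    have w: "region_word p (insert \<beta> D) u = region_word p D u" "region_word p (insert \<beta> D) v = region_word p D v"
      if "\<beta> \<in> addable_arrows p D r" for \<beta>
    proof -
      have "region_polygon p (insert \<beta> D) t = region_polygon p D t" if "t \<in> set u \<union> set v" for t
        using that urv \<open>\<beta> \<in> _\<close> r
        by (intro region_polygon_insert_other[where r = r]) (auto simp: addable_arrows_def)
      then show "region_word p (insert \<beta> D) u = region_word p D u" "region_word p (insert \<beta> D) v = region_word p D v"
        by (simp_all add: region_word_def)
    qed
    have "(\<Sum>\<beta>\<in>addable_arrows p D r. X (insert \<beta> D) u r (Some \<beta>) v) =
      bar_insert (region_word p D u) (\<Sum>\<beta>\<in>addable_arrows p D r. scale (dissection_sgn p (insert \<beta> D))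
      (gen (region_polygon p (insert \<beta> D) r) \<and>\<^sub>e gen (region_polygon p (insert \<beta> D) (Some \<beta>)))) (region_word p D v)"
      unfolding bar_insert_sum X_def by (intro sum.cong refl) (simp add: w bar_insert_scale)
    then show "(\<Sum>\<beta>\<in>addable_arrows p D r. X (insert \<beta> D) u r (Some \<beta>) v) =
      scale (dissection_sgn p D) (bar_insert (region_word p D u)
        (del_polygon (region_polygon p D r)) (region_word p D v))"
      unfolding del_region_polygon[OF D r] by (simp add: bar_insert_scale)
  qed
  finally show ?thesis by simp
qed

theorem proposition6p13:
  fixes R :: "'r set" and p :: "'r list"
  assumes "p \<in> deco_polygons R"
  shows "bar_cocycle R 0 (bar_element p)"
  using bar_element_degree_0[OF assms] bar_differential_bar_element[of p] by (simp add: bar_cocycle_def)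

end
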